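(* Let $\kappa$ be a singular cardinal of cofinality $\omega$ with $\kappa=\beth_\kappa$, and let $\tau$ be a fixed vocabulary. Let $\mathcal K$ be the class of all models (structures) of $\tau$ and $\mathcal K^c$ the class of all weak chain models of $\tau$. Then $$(L^1_\kappa,\models_{L^1_\kappa},\mathcal K)\le (L^{c,*}_{\kappa,\kappa},\models^c,\mathcal K^c).$$
   Context: Vocabularies $\tau$ are relational, of countable size (possibly enriched with up to $\kappa$ constant symbols), with relation symbols of arity $<\kappa$. $L_{\kappa,\kappa}$ is formed like first order logic but allowing conjunctions and disjunctions of length $<\kappa$ and strings of $<\kappa$ quantifiers. Logics and their comparison. A logic is a triple $(L,\models,S)$ with $\models\,\subseteq S\times L$ ($L$ a set or class of sentences, $S$ a set or class of models). We write $(L,\models,S)\le(L',\models',S')$ if there are $f:L\to L'$ and $g:S'\to S$ such that (adjointness) for all $\varphi\in L$ and $M'\in S'$: $M'\models' f(\varphi)$ iff $g(M')\models\varphi$; and (density) for every $\varphi\in L$ for which there is $s\in S$ with $s\models\varphi$, there is $s'\in S'$ with $g(s')\models\varphi$. Chain models. A weak chain model $(A_n)_{n<\omega}$ is a $\tau$-structure $\mathfrak A$ with universe $A$ together with sets $A_n\subseteq A_{n+1}$ ($n<\omega$) such that $A=\bigcup_n A_n$. The relation $\models^c$ between weak chain models and $L_{\kappa,\kappa}$-formulas is defined by induction as the usual satisfaction relation for quantifier-free formulas and connectives, and $(A_n)_n\models^c\exists\bar x\,\varphi(\bar x)$ iff there are $n<\omega$ and a sequence $\bar a$ of elements of $A_n$,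 of the same length ($<\kappa$) as $\bar x$, with $(A_n)_n\models^c\varphi[\bar a]$. $L^{c,*}_{\kappa,\kappa}$ is the logic with the sentences of $L_{\kappa,\kappa}$, relation $\models^c$, and all weak chain models. Shelah's logic $L^1_\kappa$. For a cardinal $\theta$, an ordinal $\beta<\theta^+$ and $\tau$-structures $\mathfrak A,\mathfrak B$ with universes $A,B$, the game $\mathrm{BG}^\beta_\theta(\mathfrak A,\mathfrak B)$ is: in round $0$ Player I picks $\beta_0<\beta$, $\theta_0\le\theta$ and $A_0\in[A]^{\theta_0}$; Player II picks $h_0:A_0\to\omega$ and a partial isomorphism $g_0:h_0^{-1}(0)\to B$. In round $n\ge1$ Player I picks $\beta_n<\beta_{n-1}$ and a set $A_n\in[A]^{\theta_0}$ if $n$ is even, $B_n\in[B]^{\theta_0}$ if $n$ is odd; Player II picks a function $h_n$ from that set to $\omega$ and a partial isomorphism $g_n\supseteq g_{n-1}$ such that for all $m\le n$, $h_m^{-1}(n-m)\subseteq\mathrm{dom}(g_n)$ if $m$ is even and $h_m^{-1}(n-m)\subseteq\mathrm{ran}(g_n)$ if $m$ is odd. Eventually $\beta_n=0$ and the game ends; Player II wins if she can play to the end, otherwise Player I wins. $\mathfrak A\sim_{\beta,\theta}\mathfrak B$ iff Player II has a winning strategy, and $\equiv^\beta_\theta$ is the transitive closure of $\sim_{\beta,\theta}$. For $\beta<\theta^+$, any union of $\equiv^\beta_\theta$-equivalence classes is a sentence of $L^1_\theta$; the sentences of $L^1_\kappa$ are those of $\bigcup_{\theta<\kappa}L^1_\theta$;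 and $\mathfrak A\models_{L^1_\kappa}K$ iff $\mathfrak A\in K$.
   Formalization: Arities are assumed bounded by some μ<κ and constants number fewer than κ; with unbounded arities or κ constants L^1_κ has 2^(2^κ) inequivalent sentences but L_{κ,κ} only 2^κ, so the claim fails. Models have universes inside an arbitrary fixed set. *)

theory Defs
  imports "HOL-Library.FuncSet" "HOL-Library.Countable_Set"
begin

unbundle cardinal_syntax

text \<open>
  Throughout, \<open>\<kappa> :: 'k rel\<close> is a cardinal given as a \<open>card_order\<close> on the whole type \<open>'k\<close>, so that
  the elements of \<open>'k\<close> are exactly the ordinals below \<open>\<kappa>\<close>, and \<open>underS \<kappa> \<alpha>\<close> is the ordinal \<open>\<alpha>\<close>
  regarded as the set of its predecessors. Cardinals below \<open>\<kappa>\<close> are represented by arbitrary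
  cardinal orders of type \<open>'k rel\<close>.
\<close>

section \<open>Cardinals\<close>

definition singular_card :: "'k rel \<Rightarrow> bool" where
  "singular_card \<kappa> \<longleftrightarrow> Cinfinite \<kappa> \<and> \<not> regularCard \<kappa>"

definition has_cofinality :: "'k rel \<Rightarrow> 'b rel \<Rightarrow> bool" where
  "has_cofinality \<kappa> c \<longleftrightarrow>
     (\<exists>X \<subseteq> Field \<kappa>. cofinal X \<kappa> \<and> |X| =o c) \<and>
     (\<forall>X \<subseteq> Field \<kappa>. cofinal X \<kappa> \<longrightarrow> c \<le>o |X| )"

definition is_card_sup :: "'b rel set \<Rightarrow> 'b rel \<Rightarrow> bool" where
  "is_card_sup C c \<longleftrightarrow>
     Card_order c \<and> (\<forall>d\<in>C. d \<le>o c) \<and>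
     (\<forall>e :: 'b rel. Card_order e \<longrightarrow> (\<forall>d\<in>C. d \<le>o e) \<longrightarrow> c \<le>o e)"

definition is_successor_of :: "'k rel \<Rightarrow> 'k \<Rightarrow> 'k \<Rightarrow> bool" where
  "is_successor_of \<kappa> \<alpha> \<gamma> \<longleftrightarrow> \<gamma> \<in> underS \<kappa> \<alpha> \<and> underS \<kappa> \<alpha> = insert \<gamma> (underS \<kappa> \<gamma>)"

text \<open>
  The recursion equations of \<open>\<alpha> \<mapsto> \<beth>\<^sub>\<alpha>\<close> for \<open>\<alpha> < \<kappa>\<close>; they determine \<open>b\<close> up to equipollence.
\<close>

definition beth_sequence :: "'k rel \<Rightarrow> ('k \<Rightarrow> 'b rel) \<Rightarrow> bool" where
  "beth_sequence \<kappa> b \<longleftrightarrow> (\<forall>\<alpha> \<in> Field \<kappa>.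
     Card_order (b \<alpha>) \<and>
     (underS \<kappa> \<alpha> = {} \<longrightarrow> b \<alpha> =o natLeq) \<and>
     (\<forall>\<gamma>. is_successor_of \<kappa> \<alpha> \<gamma> \<longrightarrow> b \<alpha> =o |Pow (Field (b \<gamma>))| ) \<and>
     (underS \<kappa> \<alpha> \<noteq> {} \<and> (\<nexists>\<gamma>. is_successor_of \<kappa> \<alpha> \<gamma>) \<longrightarrow> is_card_sup (b ` underS \<kappa> \<alpha>) (b \<alpha>)))"

text \<open>
  An infinite cardinal \<open>\<kappa>\<close> is a limit ordinal, so \<open>\<beth>\<^sub>\<kappa> = sup {\<beth>\<^sub>\<alpha> | \<alpha> < \<kappa>}\<close>. If this supremum
  is \<open>\<kappa>\<close>, then all the \<open>\<beth>\<^sub>\<alpha>\<close> with \<open>\<alpha> < \<kappa>\<close> are represented on the type \<open>'k\<close>.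
\<close>

definition beth_fixed_point :: "'k rel \<Rightarrow> bool" where
  "beth_fixed_point \<kappa> \<longleftrightarrow>
     (\<exists>b :: 'k \<Rightarrow> 'k rel. beth_sequence \<kappa> b \<and> is_card_sup (b ` Field \<kappa>) \<kappa>)"

definition subsets_of_card :: "'a set \<Rightarrow> 'k rel \<Rightarrow> 'a set set" where
  "subsets_of_card A \<theta> = {X. X \<subseteq> A \<and> |X| =o \<theta>}"

section \<open>Vocabularies, structures and weak chain models\<close>

record ('r, 'c, 'k) vocab =
  rel_syms :: "'r set"
  cst_syms :: "'c set"
  arity :: "'r \<Rightarrow> 'k"

text \<open>
  Countably many relation symbols, of (possibly infinite) arities below \<open>\<kappa>\<close>, and fewer than \<open>\<kappa>\<close>
  constant symbols. As \<open>\<kappa>\<close> is singular of countable cofinality, it matters that the arities have a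
  common bound below \<open>\<kappa>\<close>: otherwise there would already be \<open>2\<^sup>\<kappa>\<close> isomorphism types of
  two-element structures, and hence more sentences of Shelah's logic, no two of them equivalent,
  than sentences of \<open>L\<^sub>\<kappa>\<^sub>\<kappa>\<close>. The same happens with \<open>\<kappa>\<close> constant symbols.
\<close>

definition vocabulary :: "'k rel \<Rightarrow> ('r, 'c, 'k) vocab \<Rightarrow> bool" where
  "vocabulary \<kappa> \<tau> \<longleftrightarrow>
     countable (rel_syms \<tau>) \<and> |cst_syms \<tau>| <o \<kappa> \<and>
     (\<exists>\<mu> \<in> Field \<kappa>. \<forall>R \<in> rel_syms \<tau>. (arity \<tau> R, \<mu>) \<in> \<kappa>)"

definition tuples :: "'k rel \<Rightarrow> 'k \<Rightarrow> 'a set \<Rightarrow> ('k \<Rightarrow> 'a) set" where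
  "tuples \<kappa> \<alpha> X = (underS \<kappa> \<alpha> \<rightarrow>\<^sub>E X)"

record ('r, 'c, 'k, 'a) struct =
  univ :: "'a set"
  rel :: "'r \<Rightarrow> ('k \<Rightarrow> 'a) set"
  cst :: "'c \<Rightarrow> 'a"

text \<open>
  Symbols outside \<open>\<tau>\<close> receive fixed dummy interpretations, so that equality of elements of
  \<open>structures \<kappa> \<tau>\<close> is equality of \<open>\<tau>\<close>-structures.
\<close>

definition structures ::
  "'k rel \<Rightarrow> ('r, 'c, 'k) vocab \<Rightarrow> ('r, 'c, 'k, 'a) struct set" where
  "structures \<kappa> \<tau> = {M. univ M \<noteq> {} \<and>
     (\<forall>R \<in> rel_syms \<tau>. rel M R \<subseteq> tuples \<kappa> (arity \<tau> R) (univ M)) \<and>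
     (\<forall>c \<in> cst_syms \<tau>. cst M c \<in> univ M) \<and>
     (\<forall>R. R \<notin> rel_syms \<tau> \<longrightarrow> rel M R = {}) \<and>
     (\<forall>c. c \<notin> cst_syms \<tau> \<longrightarrow> cst M c = undefined)}"

type_synonym ('r, 'c, 'k, 'a) chain_struct = "('r, 'c, 'k, 'a) struct \<times> (nat \<Rightarrow> 'a set)"

definition weak_chain_models ::
  "'k rel \<Rightarrow> ('r, 'c, 'k) vocab \<Rightarrow> ('r, 'c, 'k, 'a) chain_struct set" where
  "weak_chain_models \<kappa> \<tau> =
     {(M, A). M \<in> structures \<kappa> \<tau> \<and> (\<forall>n. A n \<subseteq> A (Suc n)) \<and> univ M = (\<Union>n. A n)}"

section \<open>The sentences of \<open>L\<^sub>\<kappa>\<^sub>\<kappa>\<close> and their chain semantics\<close>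

text \<open>There are \<open>\<kappa>\<close> variables, named by the elements of \<open>'k\<close>.\<close>

datatype ('c, 'k) trm = Var 'k | Cst 'c

text \<open>
  \<open>FConj \<alpha> F\<close> and \<open>FDisj \<alpha> F\<close> are the conjunction and disjunction of the sequence
  \<open>(F i)\<close>, \<open>i < \<alpha>\<close>, and \<open>FEx \<alpha> x \<phi>\<close> quantifies the string of variables \<open>(x i)\<close>, \<open>i < \<alpha>\<close>.
  Only the first \<open>arity \<tau> R\<close> entries of \<open>t\<close> matter in \<open>FRel R t\<close>.
\<close>

datatype ('r, 'c, 'k) form =
    FEq "('c, 'k) trm" "('c, 'k) trm"
  | FRel 'r "'k \<Rightarrow> ('c, 'k) trm"
  | FNeg "('r, 'c, 'k) form"
  | FConj 'k "'k \<Rightarrow> ('r, 'c, 'k) form"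
  | FDisj 'k "'k \<Rightarrow> ('r, 'c, 'k) form"
  | FEx 'k "'k \<Rightarrow> 'k" "('r, 'c, 'k) form"

abbreviation FAll :: "'k \<Rightarrow> ('k \<Rightarrow> 'k) \<Rightarrow> ('r, 'c, 'k) form \<Rightarrow> ('r, 'c, 'k) form" where
  "FAll \<alpha> x \<phi> \<equiv> FNeg (FEx \<alpha> x (FNeg \<phi>))"

primrec trm_vars :: "('c, 'k) trm \<Rightarrow> 'k set" where
  "trm_vars (Var v) = {v}"
| "trm_vars (Cst c) = {}"

primrec trm_csts :: "('c, 'k) trm \<Rightarrow> 'c set" where
  "trm_csts (Var v) = {}"
| "trm_csts (Cst c) = {c}"

primrec is_formula :: "'k rel \<Rightarrow> ('r, 'c, 'k) vocab \<Rightarrow> ('r, 'c, 'k) form \<Rightarrow> bool" where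
  "is_formula \<kappa> \<tau> (FEq t u) \<longleftrightarrow> trm_csts t \<subseteq> cst_syms \<tau> \<and> trm_csts u \<subseteq> cst_syms \<tau>"
| "is_formula \<kappa> \<tau> (FRel R t) \<longleftrightarrow>
     R \<in> rel_syms \<tau> \<and> (\<forall>i \<in> underS \<kappa> (arity \<tau> R). trm_csts (t i) \<subseteq> cst_syms \<tau>)"
| "is_formula \<kappa> \<tau> (FNeg \<phi>) \<longleftrightarrow> is_formula \<kappa> \<tau> \<phi>"
| "is_formula \<kappa> \<tau> (FConj \<alpha> F) \<longleftrightarrow> (\<forall>i \<in> underS \<kappa> \<alpha>. is_formula \<kappa> \<tau> (F i))"
| "is_formula \<kappa> \<tau> (FDisj \<alpha> F) \<longleftrightarrow> (\<forall>i \<in> underS \<kappa> \<alpha>. is_formula \<kappa> \<tau> (F i))"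
| "is_formula \<kappa> \<tau> (FEx \<alpha> x \<phi>) \<longleftrightarrow> inj_on x (underS \<kappa> \<alpha>) \<and> is_formula \<kappa> \<tau> \<phi>"

primrec free_vars :: "'k rel \<Rightarrow> ('r, 'c, 'k) vocab \<Rightarrow> ('r, 'c, 'k) form \<Rightarrow> 'k set" where
  "free_vars \<kappa> \<tau> (FEq t u) = trm_vars t \<union> trm_vars u"
| "free_vars \<kappa> \<tau> (FRel R t) = (\<Union>i \<in> underS \<kappa> (arity \<tau> R). trm_vars (t i))"
| "free_vars \<kappa> \<tau> (FNeg \<phi>) = free_vars \<kappa> \<tau> \<phi>"
| "free_vars \<kappa> \<tau> (FConj \<alpha> F) = (\<Union>i \<in> underS \<kappa> \<alpha>. free_vars \<kappa> \<tau> (F i))"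
| "free_vars \<kappa> \<tau> (FDisj \<alpha> F) = (\<Union>i \<in> underS \<kappa> \<alpha>. free_vars \<kappa> \<tau> (F i))"
| "free_vars \<kappa> \<tau> (FEx \<alpha> x \<phi>) = free_vars \<kappa> \<tau> \<phi> - x ` underS \<kappa> \<alpha>"

definition Lkk_sentences :: "'k rel \<Rightarrow> ('r, 'c, 'k) vocab \<Rightarrow> ('r, 'c, 'k) form set" where
  "Lkk_sentences \<kappa> \<tau> = {\<phi>. is_formula \<kappa> \<tau> \<phi> \<and> free_vars \<kappa> \<tau> \<phi> = {}}"

primrec trm_val :: "('r, 'c, 'k, 'a) struct \<Rightarrow> ('k \<Rightarrow> 'a) \<Rightarrow> ('c, 'k) trm \<Rightarrow> 'a" where
  "trm_val M s (Var v) = s v"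
| "trm_val M s (Cst c) = cst M c"

text \<open>
  In the clause for \<open>FEx\<close> the witnessing sequence is \<open>s' (x i)\<close>, \<open>i < \<alpha>\<close>; all of it has to lie
  in a single member \<open>A n\<close> of the chain.
\<close>

primrec chain_sat ::
  "'k rel \<Rightarrow> ('r, 'c, 'k) vocab \<Rightarrow> ('r, 'c, 'k, 'a) chain_struct \<Rightarrow>
   ('r, 'c, 'k) form \<Rightarrow> ('k \<Rightarrow> 'a) \<Rightarrow> bool" where
  "chain_sat \<kappa> \<tau> P (FEq t u) s \<longleftrightarrow> trm_val (fst P) s t = trm_val (fst P) s u"
| "chain_sat \<kappa> \<tau> P (FRel R t) s \<longleftrightarrow>
     restrict (\<lambda>i. trm_val (fst P) s (t i)) (underS \<kappa> (arity \<tau> R)) \<in> rel (fst P) R"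
| "chain_sat \<kappa> \<tau> P (FNeg \<phi>) s \<longleftrightarrow> \<not> chain_sat \<kappa> \<tau> P \<phi> s"
| "chain_sat \<kappa> \<tau> P (FConj \<alpha> F) s \<longleftrightarrow> (\<forall>i \<in> underS \<kappa> \<alpha>. chain_sat \<kappa> \<tau> P (F i) s)"
| "chain_sat \<kappa> \<tau> P (FDisj \<alpha> F) s \<longleftrightarrow> (\<exists>i \<in> underS \<kappa> \<alpha>. chain_sat \<kappa> \<tau> P (F i) s)"
| "chain_sat \<kappa> \<tau> P (FEx \<alpha> x \<phi>) s \<longleftrightarrow>
     (\<exists>n s'. (\<forall>i \<in> underS \<kappa> \<alpha>. s' (x i) \<in> snd P n) \<and>
             (\<forall>v. v \<notin> x ` underS \<kappa> \<alpha> \<longrightarrow> s' v = s v) \<and>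
             chain_sat \<kappa> \<tau> P \<phi> s')"

definition chain_models ::
  "'k rel \<Rightarrow> ('r, 'c, 'k) vocab \<Rightarrow> ('r, 'c, 'k, 'a) chain_struct \<Rightarrow> ('r, 'c, 'k) form \<Rightarrow> bool" where
  "chain_models \<kappa> \<tau> P \<phi> \<longleftrightarrow> (\<forall>s. range s \<subseteq> univ (fst P) \<longrightarrow> chain_sat \<kappa> \<tau> P \<phi> s)"

section \<open>Shelah's game and the logic \<open>L\<^sup>1\<^sub>\<kappa>\<close>\<close>

text \<open>
  A partial isomorphism extends to an isomorphism of the generated substructures; with only
  relation and constant symbols, generating adds just the interpretations of the constants.
\<close>

definition generated ::
  "('r, 'c, 'k) vocab \<Rightarrow> ('r, 'c, 'k, 'a) struct \<Rightarrow> 'a set \<Rightarrow> 'a set" where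
  "generated \<tau> M X = X \<union> cst M ` cst_syms \<tau>"

definition partial_iso ::
  "'k rel \<Rightarrow> ('r, 'c, 'k) vocab \<Rightarrow> ('r, 'c, 'k, 'a) struct \<Rightarrow> ('r, 'c, 'k, 'a) struct \<Rightarrow>
   ('a \<rightharpoonup> 'a) \<Rightarrow> bool" where
  "partial_iso \<kappa> \<tau> M N g \<longleftrightarrow>
     dom g \<subseteq> univ M \<and> ran g \<subseteq> univ N \<and>
     (\<exists>\<rho>. bij_betw \<rho> (generated \<tau> M (dom g)) (generated \<tau> N (ran g)) \<and>
          (\<forall>a \<in> dom g. g a = Some (\<rho> a)) \<and>
          (\<forall>c \<in> cst_syms \<tau>. \<rho> (cst M c) = cst N c) \<and>
          (\<forall>R \<in> rel_syms \<tau>. \<forall>a \<in> tuples \<kappa> (arity \<tau> R) (generated \<tau> M (dom g)).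
             a \<in> rel M R \<longleftrightarrow> restrict (\<lambda>i. \<rho> (a i)) (underS \<kappa> (arity \<tau> R)) \<in> rel N R))"

text \<open>
  A play of Player I consists of \<open>\<theta>\<^sub>0\<close> and the list of pairs \<open>(\<beta>\<^sub>n, X\<^sub>n)\<close>, where \<open>X\<^sub>n\<close> is \<open>A\<^sub>n\<close> for
  even and \<open>B\<^sub>n\<close> for odd \<open>n\<close>. Player II answers with pairs \<open>(h\<^sub>n, g\<^sub>n)\<close>, where only the values of
  \<open>h\<^sub>n\<close> on \<open>X\<^sub>n\<close> count.
\<close>

type_synonym ('k, 'a) movesI = "('k \<times> 'a set) list"
type_synonym 'a moveII = "('a \<Rightarrow> nat) \<times> ('a \<rightharpoonup> 'a)"
type_synonym ('k, 'a) strategyII = "'k rel \<Rightarrow> ('k, 'a) movesI \<Rightarrow> 'a moveII"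

definition legal_playI ::
  "'k rel \<Rightarrow> ('r, 'c, 'k, 'a) struct \<Rightarrow> ('r, 'c, 'k, 'a) struct \<Rightarrow> 'k \<Rightarrow> 'k rel \<Rightarrow>
   'k rel \<Rightarrow> ('k, 'a) movesI \<Rightarrow> bool" where
  "legal_playI \<kappa> M N \<beta> \<theta> \<theta>\<^sub>0 p \<longleftrightarrow>
     Card_order \<theta>\<^sub>0 \<and> \<theta>\<^sub>0 \<le>o \<theta> \<and>
     (\<forall>n < length p.
        fst (p ! n) \<in> underS \<kappa> (if n = 0 then \<beta> else fst (p ! (n - 1))) \<and>
        snd (p ! n) \<in> subsets_of_card (if even n then univ M else univ N) \<theta>\<^sub>0)"

definition block :: "('k, 'a) movesI \<Rightarrow> 'a moveII list \<Rightarrow> nat \<Rightarrow> nat \<Rightarrow> 'a set" where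
  "block p q m j = {x \<in> snd (p ! m). fst (q ! m) x = j}"

definition legal_replyII ::
  "'k rel \<Rightarrow> ('r, 'c, 'k) vocab \<Rightarrow> ('r, 'c, 'k, 'a) struct \<Rightarrow> ('r, 'c, 'k, 'a) struct \<Rightarrow>
   ('k, 'a) movesI \<Rightarrow> 'a moveII list \<Rightarrow> nat \<Rightarrow> bool" where
  "legal_replyII \<kappa> \<tau> M N p q n \<longleftrightarrow>
     partial_iso \<kappa> \<tau> M N (snd (q ! n)) \<and>
     (n = 0 \<longrightarrow> dom (snd (q ! 0)) = block p q 0 0) \<and>
     (n > 0 \<longrightarrow> snd (q ! (n - 1)) \<subseteq>\<^sub>m snd (q ! n) \<and>
        (\<forall>m \<le> n. if even m then block p q m (n - m) \<subseteq> dom (snd (q ! n))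
                 else block p q m (n - m) \<subseteq> ran (snd (q ! n))))"

definition repliesII :: "('k, 'a) strategyII \<Rightarrow> 'k rel \<Rightarrow> ('k, 'a) movesI \<Rightarrow> 'a moveII list" where
  "repliesII \<sigma> \<theta>\<^sub>0 p = map (\<lambda>n. \<sigma> \<theta>\<^sub>0 (take (Suc n) p)) [0..<length p]"

text \<open>
  As the ordinals decrease, every play is finite, and it ends at the latest when Player I has chosen
  the ordinal 0. A strategy wins iff all of its replies are legal; in particular, Player II does not
  lose when Player I is left without a legal move.
\<close>

definition winning_strategyII ::
  "'k rel \<Rightarrow> ('r, 'c, 'k) vocab \<Rightarrow> ('r, 'c, 'k, 'a) struct \<Rightarrow> ('r, 'c, 'k, 'a) struct \<Rightarrow>
   'k \<Rightarrow> 'k rel \<Rightarrow> ('k, 'a) strategyII \<Rightarrow> bool" where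
  "winning_strategyII \<kappa> \<tau> M N \<beta> \<theta> \<sigma> \<longleftrightarrow>
     (\<forall>\<theta>\<^sub>0 p. legal_playI \<kappa> M N \<beta> \<theta> \<theta>\<^sub>0 p \<longrightarrow>
        (\<forall>n < length p. legal_replyII \<kappa> \<tau> M N p (repliesII \<sigma> \<theta>\<^sub>0 p) n))"

definition bg_sim ::
  "'k rel \<Rightarrow> ('r, 'c, 'k) vocab \<Rightarrow> 'k \<Rightarrow> 'k rel \<Rightarrow> ('r, 'c, 'k, 'a) struct rel" where
  "bg_sim \<kappa> \<tau> \<beta> \<theta> = {(M, N). M \<in> structures \<kappa> \<tau> \<and> N \<in> structures \<kappa> \<tau> \<and>
     (\<exists>\<sigma>. winning_strategyII \<kappa> \<tau> M N \<beta> \<theta> \<sigma>)}"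

definition bg_equiv ::
  "'k rel \<Rightarrow> ('r, 'c, 'k) vocab \<Rightarrow> 'k \<Rightarrow> 'k rel \<Rightarrow> ('r, 'c, 'k, 'a) struct rel" where
  "bg_equiv \<kappa> \<tau> \<beta> \<theta> = (bg_sim \<kappa> \<tau> \<beta> \<theta>)\<^sup>+"

text \<open>
  \<open>Restr \<kappa> (underS \<kappa> \<beta>)\<close> is the well-order of type \<open>\<beta>\<close>; the condition below says \<open>\<beta> < \<theta>\<^sup>+\<close>.
  For \<open>\<theta> < \<kappa>\<close>, and \<open>\<kappa>\<close> a limit cardinal, all such ordinals are below \<open>\<kappa>\<close>. The quotient is
  formed with the bare transitive closure: its members are the sets \<open>bg_equiv \<kappa> \<tau> \<beta> \<theta> `` {M}\<close>.
  As \<open>bg_sim\<close> is reflexive, every set closed under \<open>bg_sim\<close> is a union of such classes, so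
  all unions of classes of the equivalence relation generated by \<open>bg_sim\<close> are included.
\<close>

definition L1_theta_sentences ::
  "'k rel \<Rightarrow> ('r, 'c, 'k) vocab \<Rightarrow> 'k rel \<Rightarrow> ('r, 'c, 'k, 'a) struct set set" where
  "L1_theta_sentences \<kappa> \<tau> \<theta> =
     {K. \<exists>\<beta> \<in> Field \<kappa>. Restr \<kappa> (underS \<kappa> \<beta>) <o cardSuc \<theta> \<and>
           (\<exists>\<C> \<subseteq> structures \<kappa> \<tau> // bg_equiv \<kappa> \<tau> \<beta> \<theta>. K = \<Union>\<C>)}"

definition L1_sentences ::
  "'k rel \<Rightarrow> ('r, 'c, 'k) vocab \<Rightarrow> ('r, 'c, 'k, 'a) struct set set" where
  "L1_sentences \<kappa> \<tau> = (\<Union>\<theta> \<in> {\<theta>. Card_order \<theta> \<and> \<theta> <o \<kappa>}. L1_theta_sentences \<kappa> \<tau> \<theta>)"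

definition L1_models :: "('r, 'c, 'k, 'a) struct \<Rightarrow> ('r, 'c, 'k, 'a) struct set \<Rightarrow> bool" where
  "L1_models M K \<longleftrightarrow> M \<in> K"

section \<open>Comparison of logics\<close>

type_synonym ('l, 's) logic = "'l set \<times> ('s \<Rightarrow> 'l \<Rightarrow> bool) \<times> 's set"

fun logic_le :: "('l, 's) logic \<Rightarrow> ('m, 't) logic \<Rightarrow> bool" where
  "logic_le (L, sat, S) (L', sat', S') \<longleftrightarrow>
     (\<exists>f \<in> L \<rightarrow> L'. \<exists>g \<in> S' \<rightarrow> S.
        (\<forall>\<phi> \<in> L. \<forall>M' \<in> S'. sat' M' (f \<phi>) \<longleftrightarrow> sat (g M') \<phi>) \<and>
        (\<forall>\<phi> \<in> L. (\<exists>s \<in> S. sat s \<phi>) \<longrightarrow> (\<exists>s' \<in> S'. sat (g s') \<phi>)))"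

end

theory Submission
  imports Defs
begin

text \<open>
  Weak chain models are sent to structures by forgetting the chain. Density is then immediate, as
  every structure \<open>M\<close> carries the constant chain \<open>A\<^sub>n = M\<close>. What remains is to find, for every sentence
  \<open>K\<close> of \<open>L\<^sup>1\<^sub>\<kappa>\<close>, a sentence of \<open>L\<^sub>\<kappa>\<^sub>\<kappa>\<close> that holds, in the chain semantics, exactly in the weak chain
  models over members of \<open>K\<close>. Let \<open>K\<close> be a union of classes of the equivalence with parameters
  \<open>\<beta>\<close> and \<open>\<theta>\<close>; it is closed under \<open>\<sim>\<^sub>\<beta>\<^sub>,\<^sub>\<theta>\<close> (\<open>bg_sim_closed\<close>).

  Arrange variables in rows \<open>0, 1, 2, \<dots>\<close> of a fixed length \<open>\<iota> < \<kappa>\<close> with at least \<open>\<theta>\<close> places.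
  A basic formula of rank \<open>\<gamma>\<close> about the first \<open>n\<close> rows is atomic, or says that row \<open>n\<close> can be chosen
  such that prescribed basic formulas of some rank \<open>\<delta> < \<gamma>\<close> about the first \<open>n + 1\<close> rows are true and
  others are false. These formulas have two properties.

  There are fewer than \<open>\<kappa>\<close> of them in each rank (\<open>basic_ordLess\<close>). Every step in the rank costs one
  power set, and as \<open>\<kappa> = \<beth>\<^sub>\<kappa>\<close>, power sets can be iterated through all \<open>\<gamma> < \<kappa>\<close>, starting from any
  cardinal below \<open>\<kappa>\<close>, without ever reaching \<open>\<kappa>\<close> (\<open>iterated_powers\<close>). Hence the set of basic
  sentences of rank \<open>\<beta>\<close> that hold in a given weak chain model is described by one sentence, and any
  set of such descriptions has a disjunction in \<open>L\<^sub>\<kappa>\<^sub>\<kappa>\<close>.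

  If \<open>(A\<^sub>n)\<close> and \<open>(B\<^sub>n)\<close> satisfy the same basic sentences of rank \<open>\<beta>\<close>, then Player II wins Shelah's
  game between the underlying structures (\<open>agree_bg_sim\<close>). The chains tell her how to split the sets
  of Player I: if \<open>k\<close> is least with \<open>x\<close> in the \<open>k\<close>-th member of the chain, she puts
  \<open>h(x) = 2k\<close>. A set played in an even round is then due only in even rounds, and a set played in an
  odd round only in odd rounds, so each round asks for elements of one of the two structures, and
  those due in round \<open>n\<close> all lie in the \<open>n\<close>-th member of its chain. They fit into one row of
  variables, chosen within a single member of the chain, which is what a quantifier of the chain
  semantics ranges over, and the decrease of Player I's ordinal provides the decrease in rank.

  The disjunction of the descriptions of all weak chain models over members of \<open>K\<close> is therefore the
  required sentence.
\<close>

section \<open>Iterated power sets below a fixed point of the beth function\<close>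

lemma card_of_Pow_mono: "|A| \<le>o |B| \<Longrightarrow> |Pow A| \<le>o |Pow B|"
proof -
  assume "|A| \<le>o |B|"
  then obtain f where "inj_on f A" "f ` A \<subseteq> B"
    using card_of_ordLeq by metis
  then have "inj_on (image f) (Pow A)" "image f ` Pow A \<subseteq> Pow B"
    by (auto intro: inj_on_image_Pow)
  then show "|Pow A| \<le>o |Pow B|"
    using card_of_ordLeq by blast
qed

locale beth_fixed =
  fixes \<kappa> :: "'k rel"
  assumes card_order: "card_order \<kappa>"
    and Cinfinite: "Cinfinite \<kappa>"
    and beth_fixed: "beth_fixed_point \<kappa>"
begin

lemma Field_UNIV [simp]: "Field \<kappa> = UNIV"
  using card_order_on_Card_order[OF card_order] by simp

lemma Card: "Card_order \<kappa>"
  using card_order by simp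

lemma wo: "wo_rel \<kappa>"
  using Card by (simp add: wo_rel_def card_order_on_well_order_on)

lemma UNIV_card: "|UNIV :: 'k set| =o \<kappa>"
  using card_of_Field_ordIso[OF Card] by simp

lemma infinite_UNIV: "infinite (UNIV :: 'k set)"
  using Cinfinite by (simp add: cinfinite_def)

lemma underS_card: "|underS \<kappa> \<alpha>| <o \<kappa>"
  by (rule card_of_underS[OF Card]) simp

lemma underS_irrefl: "\<alpha> \<notin> underS \<kappa> \<alpha>"
  by (simp add: underS_def)

lemma underS_trans: "\<alpha> \<in> underS \<kappa> \<beta> \<Longrightarrow> \<beta> \<in> underS \<kappa> \<gamma> \<Longrightarrow> \<alpha> \<in> underS \<kappa> \<gamma>"
  using wo_rel.TRANS[OF wo] wo_rel.ANTISYM[OF wo]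
  unfolding underS_def trans_def antisym_def by blast

lemma underS_total: "\<alpha> = \<beta> \<or> \<alpha> \<in> underS \<kappa> \<beta> \<or> \<beta> \<in> underS \<kappa> \<alpha>"
  using wo_rel.TOTALS[OF wo] unfolding underS_def by auto

lemma underS_induct [case_names less]:
  assumes "\<And>\<beta>. (\<And>\<alpha>. \<alpha> \<in> underS \<kappa> \<beta> \<Longrightarrow> P \<alpha>) \<Longrightarrow> P \<beta>"
  shows "P \<beta>"
  by (rule wo_rel.well_order_induct[OF wo]) (rule assms, simp add: underS_def)

lemma successor_exists: "\<exists>\<beta>. is_successor_of \<kappa> \<beta> \<alpha>"
proof -
  obtain \<beta>0 where "\<alpha> \<in> underS \<kappa> \<beta>0"
    using Cinfinite_limit[of \<alpha> \<kappa>] Cinfinite by (auto simp: underS_def)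
  then obtain \<beta> where \<beta>: "\<alpha> \<in> underS \<kappa> \<beta>" "\<And>\<gamma>. \<gamma> \<in> underS \<kappa> \<beta> \<Longrightarrow> \<alpha> \<notin> underS \<kappa> \<gamma>"
  proof (induction \<beta>0 arbitrary: thesis rule: underS_induct)
    case (less \<beta>)
    then show ?case by blast
  qed
  then have "underS \<kappa> \<beta> = insert \<alpha> (underS \<kappa> \<alpha>)"
    using underS_trans underS_total by blast
  with \<beta> show ?thesis
    unfolding is_successor_of_def by blast
qed

text \<open>
  As \<open>\<kappa>\<close> is an initial ordinal, a smaller cardinal is itself one of the ordinals below \<open>\<kappa>\<close>, that is,
  some \<open>underS \<kappa> \<alpha>\<close>.
\<close>

lemma ordLess_bij_underS:
  assumes "|A| <o \<kappa>"
  obtains \<alpha> F where "bij_betw F (underS \<kappa> \<alpha>) A"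
proof -
  obtain \<alpha> where \<alpha>: "|A| =o Restr \<kappa> (underS \<kappa> \<alpha>)"
    using assms ordLess_iff_ordIso_Restr[OF _ card_of_Well_order] wo wo_rel_def by metis
  have "Field (Restr \<kappa> (underS \<kappa> \<alpha>)) = underS \<kappa> \<alpha>"
    using Field_Restr_ofilter[OF _ wo_rel.underS_ofilter[OF wo]] wo wo_rel_def by blast
  then have "|A| =o |underS \<kappa> \<alpha>|"
    using card_of_cong[OF \<alpha>] by (simp add: Field_card_of)
  then show ?thesis
    using that card_of_ordIso ordIso_symmetric by metis
qed

lemma ordLess_image:
  assumes "|A| <o \<kappa>"
  obtains B :: "'k set" where "|B| =o |A|"
  using ordLess_bij_underS[OF assms] card_of_ordIso by metis

context
  fixes b :: "'k \<Rightarrow> 'k rel"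
  assumes b: "beth_sequence \<kappa> b"
begin

lemma beth_Card_order: "Card_order (b \<alpha>)"
  using b by (simp add: beth_sequence_def)

lemma beth_Field: "|Field (b \<alpha>)| =o b \<alpha>"
  using beth_Card_order by (rule card_of_Field_ordIso)

lemma beth_successor: "is_successor_of \<kappa> \<beta> \<alpha> \<Longrightarrow> b \<beta> =o |Pow (Field (b \<alpha>))|"
  using b by (simp add: beth_sequence_def)

lemma beth_less_Pow: "b \<alpha> <o |Pow (Field (b \<alpha>))|"
  using beth_Card_order by (rule Card_order_Pow)

text \<open>
  At a limit \<open>\<beta>\<close>, the power set of \<open>\<beth>\<^sub>\<alpha>\<close> has size \<open>\<beth>\<^sub>\<gamma>\<close> for the successor \<open>\<gamma>\<close> of \<open>\<alpha>\<close>, which is still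
  below \<open>\<beta>\<close>; at a successor \<open>\<beta>\<close>, induction applies to its predecessor.
\<close>

lemma beth_Pow_le: "\<alpha> \<in> underS \<kappa> \<beta> \<Longrightarrow> |Pow (Field (b \<alpha>))| \<le>o b \<beta>"
proof (induction \<beta> rule: underS_induct)
  case (less \<beta>)
  show ?case
  proof (cases "\<exists>\<gamma>. is_successor_of \<kappa> \<beta> \<gamma>")
    case True
    then obtain \<gamma> where \<gamma>: "is_successor_of \<kappa> \<beta> \<gamma>" by blast
    then consider "\<alpha> = \<gamma>" | "\<alpha> \<in> underS \<kappa> \<gamma>"
      using less.prems unfolding is_successor_of_def by blast
    then show ?thesis
    proof cases
      case 1
      then show ?thesis
        using beth_successor[OF \<gamma>] ordIso_symmetric ordIso_imp_ordLeq by blast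
    next
      case 2
      then have "|Pow (Field (b \<alpha>))| \<le>o b \<gamma>"
        using less.IH \<gamma> is_successor_of_def by metis
      also have "b \<gamma> \<le>o |Pow (Field (b \<gamma>))|"
        using beth_less_Pow by (rule ordLess_imp_ordLeq)
      also have "|Pow (Field (b \<gamma>))| =o b \<beta>"
        using beth_successor[OF \<gamma>] by (rule ordIso_symmetric)
      finally show ?thesis .
    qed
  next
    case False
    then have sup: "is_card_sup (b ` underS \<kappa> \<beta>) (b \<beta>)"
      using b less.prems unfolding beth_sequence_def by auto
    obtain \<gamma> where \<gamma>: "is_successor_of \<kappa> \<gamma> \<alpha>"
      using successor_exists by blast
    then have "\<gamma> \<in> underS \<kappa> \<beta>"
      using False less.prems underS_total[of \<gamma> \<beta>] underS_irrefl underS_trans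
      unfolding is_successor_of_def by blast
    then have "b \<gamma> \<le>o b \<beta>"
      using sup unfolding is_card_sup_def by blast
    then show ?thesis
      using beth_successor[OF \<gamma>] ordIso_symmetric ordIso_ordLeq_trans by blast
  qed
qed

lemma beth_mono:
  assumes "(\<alpha>, \<beta>) \<in> \<kappa>"
  shows "b \<alpha> \<le>o b \<beta>"
proof (cases "\<alpha> = \<beta>")
  case True
  then show ?thesis
    using ordLeq_reflexive card_order_on_well_order_on beth_Card_order by blast
next
  case False
  then have "\<alpha> \<in> underS \<kappa> \<beta>"
    using assms by (simp add: underS_def)
  then show ?thesis
    using beth_Pow_le beth_less_Pow ordLess_ordLeq_trans ordLess_imp_ordLeq by metis
qed

end

text \<open>
  The sequence is \<open>\<beth>\<close> with its index shifted: some \<open>\<beth>\<^sub>\<alpha>\<close> is at least \<open>|C|\<close>, and \<open>D \<gamma>\<close> has size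
  \<open>\<beth>\<close> at \<open>f \<gamma>\<close> for a strictly increasing \<open>f\<close> with values at or above \<open>\<alpha>\<close>. Instead of ordinal
  addition, \<open>f\<close> is an order embedding of \<open>\<kappa>\<close> into its final segment from \<open>\<alpha>\<close> on, which exists because
  this segment still has cardinality \<open>\<kappa>\<close>.
\<close>

lemma iterated_powers:
  assumes C: "|C| <o \<kappa>"
  obtains D :: "'k \<Rightarrow> 'k set" where "\<And>\<gamma>. |D \<gamma>| <o \<kappa>" "\<And>\<gamma>. |C| \<le>o |D \<gamma>|"
    "\<And>\<gamma> \<delta>. \<delta> \<in> underS \<kappa> \<gamma> \<Longrightarrow> |Pow (D \<delta>)| \<le>o |D \<gamma>|"
proof -
  obtain b :: "'k \<Rightarrow> 'k rel" where b: "beth_sequence \<kappa> b" "is_card_sup (b ` UNIV) \<kappa>"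
    using beth_fixed unfolding beth_fixed_point_def by auto
  note Card_b = beth_Card_order[OF b(1)]
  have less: "b \<alpha> <o \<kappa>" for \<alpha>
  proof -
    obtain \<beta> where "is_successor_of \<kappa> \<beta> \<alpha>"
      using successor_exists by blast
    then have "b \<alpha> <o b \<beta>"
      using beth_less_Pow[OF b(1)] beth_successor[OF b(1)] ordIso_symmetric
        ordLess_ordIso_trans by blast
    moreover have "b \<beta> \<le>o \<kappa>"
      using b(2) by (simp add: is_card_sup_def)
    ultimately show ?thesis
      by (rule ordLess_ordLeq_trans)
  qed
  have "\<exists>\<alpha>. |C| \<le>o b \<alpha>"
  proof (rule ccontr)
    assume "\<not> ?thesis"
    then have "b \<alpha> \<le>o |C|" for \<alpha>
      using Card_b card_of_Card_order ordLeq_total card_order_on_well_order_on by metis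
    moreover obtain B :: "'k set" where B: "|B| =o |C|"
      using ordLess_image[OF C] .
    ultimately have "b \<alpha> \<le>o |B|" for \<alpha>
      using ordLeq_ordIso_trans ordIso_symmetric by blast
    then have "\<kappa> \<le>o |B|"
      using b(2) card_of_Card_order unfolding is_card_sup_def by blast
    then have "\<kappa> \<le>o |C|"
      using B ordLeq_ordIso_trans by blast
    with C show False
      using not_ordLess_ordLeq by blast
  qed
  then obtain \<alpha> where \<alpha>: "|C| \<le>o b \<alpha>" ..
  \<comment> \<open>The final segment of \<open>\<kappa>\<close> from \<open>\<alpha>\<close> on, the complement of a set of size less than \<open>\<kappa>\<close>.\<close>
  define X where "X = {\<xi>. (\<alpha>, \<xi>) \<in> \<kappa>}"
  have "\<xi> \<in> underS \<kappa> \<alpha> \<union> X" for \<xi>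
    using underS_total[of \<xi> \<alpha>] wo_rel.REFL[OF wo]
    unfolding X_def underS_def refl_on_def by auto
  then have "underS \<kappa> \<alpha> \<union> X = UNIV"
    by blast
  have "\<not> |X| <o \<kappa>"
  proof
    assume "|X| <o \<kappa>"
    then have "|underS \<kappa> \<alpha> \<union> X| <o \<kappa>"
      using card_of_Un_ordLess_infinite_Field[OF _ Card underS_card] infinite_UNIV by simp
    then have "\<kappa> <o \<kappa>"
      using \<open>_ = UNIV\<close> UNIV_card ordIso_symmetric ordIso_ordLess_trans by metis
    then show False
      using ordLess_irreflexive by blast
  qed
  then have "\<kappa> \<le>o |X|"
    using Card card_of_Card_order not_ordLess_iff_ordLeq card_order_on_well_order_on by metis
  \<comment> \<open>A cardinal is the least order type of a well-order on a set of that size.\<close>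
  also have "|X| \<le>o Restr \<kappa> X"
    using wo_rel_def[of \<kappa>] wo by (intro card_of_least well_order_on_Restr) auto
  finally obtain f where f: "embed \<kappa> (Restr \<kappa> X) f"
    unfolding ordLeq_def by blast
  have f_X: "f \<gamma> \<in> X" for \<gamma>
    using embed_Field[OF f] Field_Restr_subset[of \<kappa> X] by auto
  have f_mono: "f \<delta> \<in> underS \<kappa> (f \<gamma>)" if "\<delta> \<in> underS \<kappa> \<gamma>" for \<delta> \<gamma>
  proof -
    have "inj f"
      using embed_inj_on[OF _ f] wo wo_rel_def by (metis Field_UNIV)
    then have "f \<delta> \<noteq> f \<gamma>"
      using that by (auto simp: underS_def inj_def)
    moreover have "(f \<delta>, f \<gamma>) \<in> Restr \<kappa> X"
      using that embed_compat[OF f] by (auto simp: underS_def compat_def)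
    ultimately show ?thesis
      by (simp add: underS_def)
  qed
  show thesis
  proof (rule that[of "\<lambda>\<gamma>. Field (b (f \<gamma>))"])
    fix \<gamma> \<delta>
    show "|Field (b (f \<gamma>))| <o \<kappa>"
      using beth_Field[OF b(1)] less ordIso_ordLess_trans by blast
    have "b \<alpha> \<le>o b (f \<gamma>)"
      using f_X by (intro beth_mono[OF b(1)]) (simp add: X_def)
    then show "|C| \<le>o |Field (b (f \<gamma>))|"
      using \<alpha> beth_Field[OF b(1)] ordLeq_transitive ordLeq_ordIso_trans ordIso_symmetric by metis
    assume "\<delta> \<in> underS \<kappa> \<gamma>"
    then show "|Pow (Field (b (f \<delta>)))| \<le>o |Field (b (f \<gamma>))|"
      using beth_Pow_le[OF b(1) f_mono] beth_Field[OF b(1)] ordLeq_ordIso_trans ordIso_symmetric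
      by blast
  qed
qed

lemma Pow_ordLess:
  assumes "|A| <o \<kappa>"
  shows "|Pow A| <o \<kappa>"
proof -
  obtain D :: "'k \<Rightarrow> 'k set" where D: "\<And>\<gamma>. |D \<gamma>| <o \<kappa>" "\<And>\<gamma>. |A| \<le>o |D \<gamma>|"
    "\<And>\<gamma> \<delta>. \<delta> \<in> underS \<kappa> \<gamma> \<Longrightarrow> |Pow (D \<delta>)| \<le>o |D \<gamma>|"
    using iterated_powers[OF assms] by blast
  obtain \<gamma> \<delta> where "\<delta> \<in> underS \<kappa> \<gamma>"
    using successor_exists is_successor_of_def by metis
  then show ?thesis
    using D card_of_Pow_mono ordLeq_transitive ordLeq_ordLess_trans by metis
qed

lemma Plus_ordLess: "|A| <o \<kappa> \<Longrightarrow> |B| <o \<kappa> \<Longrightarrow> |A <+> B| <o \<kappa>"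
  using card_of_Plus_ordLess_infinite_Field[OF _ Card] infinite_UNIV by simp

text \<open>
  If \<open>\<kappa>\<close> were countable, then \<open>\<beth>\<^sub>0 = \<omega> < \<beth>\<^sub>1 \<le> \<kappa>\<close> would be a contradiction.
\<close>

lemma nat_ordLess: "|UNIV :: nat set| <o \<kappa>"
proof -
  have "natLeq \<le>o \<kappa>"
    using Cinfinite by (simp add: natLeq_ordLeq_cinfinite)
  moreover have "\<not> \<kappa> \<le>o natLeq"
  proof
    assume *: "\<kappa> \<le>o natLeq"
    obtain b :: "'k \<Rightarrow> 'k rel" where b: "beth_sequence \<kappa> b" "is_card_sup (b ` UNIV) \<kappa>"
      using beth_fixed unfolding beth_fixed_point_def by auto
    have nat: "natLeq \<le>o b \<alpha>" for \<alpha>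
    proof (induction \<alpha> rule: underS_induct)
      case (less \<beta>)
      show ?case
      proof (cases "underS \<kappa> \<beta> = {}")
        case True
        then have "b \<beta> =o natLeq"
          using b(1) by (simp add: beth_sequence_def)
        then show ?thesis
          by (rule ordIso_imp_ordLeq[OF ordIso_symmetric])
      next
        case False
        then obtain \<alpha> where \<alpha>: "\<alpha> \<in> underS \<kappa> \<beta>" by blast
        then have "b \<alpha> \<le>o b \<beta>"
          using beth_mono[OF b(1)] by (simp add: underS_def)
        then show ?thesis
          by (rule ordLeq_transitive[OF less.IH[OF \<alpha>]])
      qed
    qed
    obtain \<alpha> \<beta> where \<alpha>: "\<alpha> \<in> underS \<kappa> \<beta>"
      using successor_exists is_successor_of_def by metis
    have "b \<alpha> <o |Pow (Field (b \<alpha>))|"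
      by (rule beth_less_Pow[OF b(1)])
    also have "|Pow (Field (b \<alpha>))| \<le>o b \<beta>"
      by (rule beth_Pow_le[OF b(1) \<alpha>])
    also have "b \<beta> \<le>o \<kappa>"
      using b(2) by (simp add: is_card_sup_def)
    also note *
    finally have "b \<alpha> <o natLeq" .
    with nat show False
      using not_ordLess_ordLeq by blast
  qed
  ultimately have "natLeq <o \<kappa>"
    using natLeq_Well_order wo not_ordLeq_iff_ordLess wo_rel_def by blast
  then show ?thesis
    using card_of_nat ordIso_ordLess_trans by blast
qed

lemma ordLess_infinite_bound:
  assumes "|A| <o \<kappa>" "|B| <o \<kappa>"
  obtains C :: "'k set" where "infinite C" "|A| \<le>o |C|" "|B| \<le>o |C|" "|C| <o \<kappa>"
proof -
  have sum: "|(A <+> B) <+> (UNIV :: nat set)| <o \<kappa>"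
    using assms nat_ordLess by (intro Plus_ordLess)
  then obtain C :: "'k set" where C: "|C| =o |(A <+> B) <+> (UNIV :: nat set)|"
    using ordLess_image by blast
  then have le: "|(A <+> B) <+> (UNIV :: nat set)| \<le>o |C|"
    using ordIso_symmetric ordIso_imp_ordLeq by blast
  show thesis
  proof
    show "|C| <o \<kappa>"
      using C sum ordIso_ordLess_trans by blast
    have "|UNIV :: nat set| \<le>o |C|"
      using le card_of_Plus2 ordLeq_transitive by blast
    then show "infinite C"
      using infinite_iff_card_of_nat by blast
    have "|A <+> B| \<le>o |C|"
      using le card_of_Plus1 ordLeq_transitive by blast
    then show "|A| \<le>o |C|" "|B| \<le>o |C|"
      using card_of_Plus1 card_of_Plus2 ordLeq_transitive by blast+
  qed
qed

lemma Un_ordLess: "|A| <o \<kappa> \<Longrightarrow> |B| <o \<kappa> \<Longrightarrow> |A \<union> B| <o \<kappa>"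
  using card_of_Un_ordLess_infinite_Field[OF _ Card] infinite_UNIV by simp

lemma Times_ordLess:
  assumes "|A| <o \<kappa>" "|B| <o \<kappa>"
  shows "|A \<times> B| <o \<kappa>"
proof -
  obtain C :: "'k set" where C: "infinite C" "|A| \<le>o |C|" "|B| \<le>o |C|" "|C| <o \<kappa>"
    using ordLess_infinite_bound[OF assms] .
  have "|A \<times> B| \<le>o |C|"
    using card_of_Sigma_ordLeq_infinite[of C A "\<lambda>_. B"] C by simp
  then show ?thesis
    using C(4) ordLeq_ordLess_trans by blast
qed

lemma image_ordLess: "|A| <o \<kappa> \<Longrightarrow> |f ` A| <o \<kappa>"
  using card_of_image ordLeq_ordLess_trans by blast

lemma subset_ordLess: "A \<subseteq> B \<Longrightarrow> |B| <o \<kappa> \<Longrightarrow> |A| <o \<kappa>"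
  using card_of_mono1 ordLeq_ordLess_trans by blast

end

section \<open>Conjunctions and disjunctions of small sets of formulas\<close>

text \<open>
  The syntax has conjunctions and disjunctions of sequences only. A set of fewer than \<open>\<kappa>\<close> formulas is
  enumerated by some ordinal below \<open>\<kappa>\<close>, and any such enumeration serves. For larger sets the values
  are arbitrary.
\<close>

definition Conj :: "'k rel \<Rightarrow> ('r, 'c, 'k) form set \<Rightarrow> ('r, 'c, 'k) form" where
  "Conj \<kappa> T = (SOME \<phi>. \<exists>\<alpha> F. \<phi> = FConj \<alpha> F \<and> F ` underS \<kappa> \<alpha> = T)"

definition Disj :: "'k rel \<Rightarrow> ('r, 'c, 'k) form set \<Rightarrow> ('r, 'c, 'k) form" where
  "Disj \<kappa> T = (SOME \<phi>. \<exists>\<alpha> F. \<phi> = FDisj \<alpha> F \<and> F ` underS \<kappa> \<alpha> = T)"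

context beth_fixed
begin

lemma ordLess_image_underS:
  assumes "|T| <o \<kappa>"
  shows "\<exists>\<alpha> F. F ` underS \<kappa> \<alpha> = T"
  using ordLess_bij_underS[OF assms] unfolding bij_betw_def by metis

lemma Conj_simps:
  assumes "|T| <o \<kappa>"
  shows "chain_sat \<kappa> \<tau> P (Conj \<kappa> T) s \<longleftrightarrow> (\<forall>\<phi>\<in>T. chain_sat \<kappa> \<tau> P \<phi> s)"
    and "is_formula \<kappa> \<tau> (Conj \<kappa> T) \<longleftrightarrow> (\<forall>\<phi>\<in>T. is_formula \<kappa> \<tau> \<phi>)"
    and "free_vars \<kappa> \<tau> (Conj \<kappa> T) = (\<Union>\<phi>\<in>T. free_vars \<kappa> \<tau> \<phi>)"
proof -
  have "\<exists>\<phi> \<alpha> F. \<phi> = FConj \<alpha> F \<and> F ` underS \<kappa> \<alpha> = T"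
    using ordLess_image_underS[OF assms] by blast
  then have "\<exists>\<alpha> F. Conj \<kappa> T = FConj \<alpha> F \<and> F ` underS \<kappa> \<alpha> = T"
    unfolding Conj_def by (rule someI_ex)
  then obtain \<alpha> F where F: "Conj \<kappa> T = FConj \<alpha> F" "F ` underS \<kappa> \<alpha> = T"
    by blast
  show "chain_sat \<kappa> \<tau> P (Conj \<kappa> T) s \<longleftrightarrow> (\<forall>\<phi>\<in>T. chain_sat \<kappa> \<tau> P \<phi> s)"
    "is_formula \<kappa> \<tau> (Conj \<kappa> T) \<longleftrightarrow> (\<forall>\<phi>\<in>T. is_formula \<kappa> \<tau> \<phi>)"
    "free_vars \<kappa> \<tau> (Conj \<kappa> T) = (\<Union>\<phi>\<in>T. free_vars \<kappa> \<tau> \<phi>)"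
    unfolding F(1) by (simp_all add: F(2)[symmetric])
qed

lemma Disj_simps:
  assumes "|T| <o \<kappa>"
  shows "chain_sat \<kappa> \<tau> P (Disj \<kappa> T) s \<longleftrightarrow> (\<exists>\<phi>\<in>T. chain_sat \<kappa> \<tau> P \<phi> s)"
    and "is_formula \<kappa> \<tau> (Disj \<kappa> T) \<longleftrightarrow> (\<forall>\<phi>\<in>T. is_formula \<kappa> \<tau> \<phi>)"
    and "free_vars \<kappa> \<tau> (Disj \<kappa> T) = (\<Union>\<phi>\<in>T. free_vars \<kappa> \<tau> \<phi>)"
proof -
  have "\<exists>\<phi> \<alpha> F. \<phi> = FDisj \<alpha> F \<and> F ` underS \<kappa> \<alpha> = T"
    using ordLess_image_underS[OF assms] by blast
  then have "\<exists>\<alpha> F. Disj \<kappa> T = FDisj \<alpha> F \<and> F ` underS \<kappa> \<alpha> = T"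
    unfolding Disj_def by (rule someI_ex)
  then obtain \<alpha> F where F: "Disj \<kappa> T = FDisj \<alpha> F" "F ` underS \<kappa> \<alpha> = T"
    by blast
  show "chain_sat \<kappa> \<tau> P (Disj \<kappa> T) s \<longleftrightarrow> (\<exists>\<phi>\<in>T. chain_sat \<kappa> \<tau> P \<phi> s)"
    "is_formula \<kappa> \<tau> (Disj \<kappa> T) \<longleftrightarrow> (\<forall>\<phi>\<in>T. is_formula \<kappa> \<tau> \<phi>)"
    "free_vars \<kappa> \<tau> (Disj \<kappa> T) = (\<Union>\<phi>\<in>T. free_vars \<kappa> \<tau> \<phi>)"
    unfolding F(1) by (simp_all add: F(2)[symmetric])
qed

end

section \<open>Basic formulas\<close>

text \<open>
  The variable at place \<open>i\<close> of row \<open>n\<close> is \<open>var n i\<close>, for \<open>i < \<iota>\<close>.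
\<close>

locale formula_rows = beth_fixed \<kappa> for \<kappa> :: "'k rel" +
  fixes \<tau> :: "('r, 'c, 'k) vocab" and \<iota> :: 'k and var :: "nat \<Rightarrow> 'k \<Rightarrow> 'k"
  assumes vocabulary: "vocabulary \<kappa> \<tau>"
    and infinite_row: "infinite (underS \<kappa> \<iota>)"
    and var_inj: "var m i = var n j \<Longrightarrow> m = n \<and> i = j"
begin

definition row :: "nat \<Rightarrow> 'k set" where
  "row n = var n ` underS \<kappa> \<iota>"

definition rows :: "nat \<Rightarrow> 'k set" where
  "rows n = (\<Union>j<n. row j)"

definition terms :: "'k set \<Rightarrow> ('c, 'k) trm set" where
  "terms W = Var ` W \<union> Cst ` cst_syms \<tau>"

definition atoms :: "'k set \<Rightarrow> ('r, 'c, 'k) form set" where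
  "atoms W = {FEq t u | t u. t \<in> terms W \<and> u \<in> terms W} \<union>
     {FRel R r | R r. R \<in> rel_syms \<tau> \<and> r \<in> underS \<kappa> (arity \<tau> R) \<rightarrow>\<^sub>E terms W}"

text \<open>
  The set \<open>T\<close> holds basic formulas and negated ones, so that it may record exactly which basic
  formulas of rank \<open>\<delta>\<close> are to be true. Rows are never reused: round \<open>n\<close> of the game is to be
  described by row \<open>n\<close>, and the finite number of rounds is covered by the finitely many rows that a
  descending sequence of ranks can introduce.
\<close>

inductive basic :: "'k \<Rightarrow> nat \<Rightarrow> ('r, 'c, 'k) form \<Rightarrow> bool" where
  atom: "\<phi> \<in> atoms (rows n) \<Longrightarrow> basic \<gamma> n \<phi>"
| ex: "\<delta> \<in> underS \<kappa> \<gamma> \<Longrightarrow>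
     \<forall>\<phi>\<in>T. basic \<delta> (Suc n) \<phi> \<or> (\<exists>\<psi>. \<phi> = FNeg \<psi> \<and> basic \<delta> (Suc n) \<psi>) \<Longrightarrow>
     basic \<gamma> n (FEx \<iota> (var n) (Conj \<kappa> T))"

definition literals :: "'k \<Rightarrow> nat \<Rightarrow> ('r, 'c, 'k) form set" where
  "literals \<gamma> n = {\<phi>. basic \<gamma> n \<phi>} \<union> FNeg ` {\<phi>. basic \<gamma> n \<phi>}"

lemma rows_Suc: "rows (Suc n) = rows n \<union> row n"
  by (auto simp: rows_def less_Suc_eq)

lemma rows_row_disjoint: "v \<in> rows n \<Longrightarrow> v \<notin> row n"
  unfolding rows_def row_def using var_inj by blast

lemma atoms_mono: "V \<subseteq> W \<Longrightarrow> atoms V \<subseteq> atoms W"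
  unfolding atoms_def terms_def by fast

lemma all_rows_ordLess: "|\<Union>n. row n| <o \<kappa>"
proof -
  have "(\<Union>n. row n) \<subseteq> (\<lambda>(n, i). var n i) ` (UNIV \<times> underS \<kappa> \<iota>)"
    by (auto simp: row_def)
  then show ?thesis
    by (rule subset_ordLess) (intro image_ordLess Times_ordLess nat_ordLess underS_card)
qed

lemma terms_ordLess: "|W| <o \<kappa> \<Longrightarrow> |terms W| <o \<kappa>"
  using vocabulary unfolding terms_def vocabulary_def
  by (intro Un_ordLess image_ordLess) auto

text \<open>
  An argument tuple of a relation symbol is determined by its graph, a subset of \<open>\<mu> \<times> terms W\<close> for
  the common bound \<open>\<mu> < \<kappa>\<close> of the arities. So the relational atoms are counted by a power set of a set
  smaller than \<open>\<kappa>\<close>, where unbounded arities would spoil the count.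
\<close>

lemma atoms_ordLess:
  assumes W: "|W| <o \<kappa>"
  shows "|atoms W| <o \<kappa>"
proof -
  have terms: "|terms W| <o \<kappa>"
    using terms_ordLess[OF W] .
  obtain \<mu> where \<mu>: "\<And>R. R \<in> rel_syms \<tau> \<Longrightarrow> underS \<kappa> (arity \<tau> R) \<subseteq> underS \<kappa> \<mu>"
    using vocabulary underS_incr[OF wo_rel.TRANS[OF wo] wo_rel.ANTISYM[OF wo]]
    unfolding vocabulary_def by metis
  have rels: "|rel_syms \<tau>| <o \<kappa>"
  proof (rule ordLeq_ordLess_trans[OF _ nat_ordLess])
    show "|rel_syms \<tau>| \<le>o |UNIV :: nat set|"
      using vocabulary unfolding vocabulary_def countable_def card_of_ordLeq[symmetric] by auto
  qed
  \<comment> \<open>Recovers a tuple from its graph and its index set.\<close>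
  define dec :: "('k \<times> ('c, 'k) trm) set \<Rightarrow> 'k set \<Rightarrow> 'k \<Rightarrow> ('c, 'k) trm" where
    "dec = (\<lambda>G D. restrict (\<lambda>i. THE t. (i, t) \<in> G) D)"
  have "FRel R r \<in> (\<lambda>(R, G). FRel R (dec G (underS \<kappa> (arity \<tau> R)))) `
      (rel_syms \<tau> \<times> Pow (underS \<kappa> \<mu> \<times> terms W))" (is "_ \<in> ?f ` ?X")
    if "R \<in> rel_syms \<tau>" "r \<in> underS \<kappa> (arity \<tau> R) \<rightarrow>\<^sub>E terms W" for R r
  proof (rule image_eqI)
    let ?G = "{(i, r i) | i. i \<in> underS \<kappa> (arity \<tau> R)}"
    have "dec ?G (underS \<kappa> (arity \<tau> R)) = r"
      using that(2) unfolding dec_def by (auto simp: fun_eq_iff PiE_def extensional_def)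
    then show "FRel R r = ?f (R, ?G)" by simp
    show "(R, ?G) \<in> ?X"
      using that \<mu> by auto
  qed
  then have "atoms W \<subseteq> (\<lambda>(t, u). FEq t u) ` (terms W \<times> terms W) \<union>
     (\<lambda>(R, G). FRel R (dec G (underS \<kappa> (arity \<tau> R)))) `
       (rel_syms \<tau> \<times> Pow (underS \<kappa> \<mu> \<times> terms W))"
    unfolding atoms_def by (intro Un_mono subsetI) auto
  then show ?thesis
    by (rule subset_ordLess)
      (intro Un_ordLess image_ordLess Times_ordLess Pow_ordLess terms rels underS_card)
qed

lemma basic_subset:
  "{\<phi>. basic \<gamma> n \<phi>} \<subseteq> atoms (\<Union>n. row n) \<union>
     (\<Union>\<delta>\<in>underS \<kappa> \<gamma>. (\<lambda>T. FEx \<iota> (var n) (Conj \<kappa> T)) ` Pow (literals \<delta> (Suc n)))"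
proof
  fix \<phi> assume "\<phi> \<in> {\<phi>. basic \<gamma> n \<phi>}"
  then have "basic \<gamma> n \<phi>" by simp
  then show "\<phi> \<in> atoms (\<Union>n. row n) \<union>
     (\<Union>\<delta>\<in>underS \<kappa> \<gamma>. (\<lambda>T. FEx \<iota> (var n) (Conj \<kappa> T)) ` Pow (literals \<delta> (Suc n)))"
  proof cases
    case atom
    have "rows n \<subseteq> (\<Union>n. row n)"
      by (auto simp: rows_def)
    with atom show ?thesis
      using atoms_mono by blast
  next
    case (ex \<delta> T)
    then have "T \<in> Pow (literals \<delta> (Suc n))"
      by (auto simp: literals_def)
    with ex show ?thesis by blast
  qed
qed

text \<open>
  By \<open>basic_subset\<close>, rank \<open>\<gamma>\<close> is covered by the atoms and by one power set for each smaller rank. Along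
  a sequence \<open>D\<close> of iterated powers that starts above the atoms and above \<open>|\<beta>|\<close>, rank \<open>\<gamma>\<close> is
  bounded by the power set of \<open>D \<gamma>\<close>: if \<open>\<delta> < \<gamma>\<close>, the bound for \<open>\<delta>\<close> is absorbed by \<open>D \<gamma>\<close>, so that
  taking sets of literals leads to the power set of \<open>D \<gamma>\<close>.
\<close>

lemma basic_ordLess: "|{\<phi>. basic \<beta> n \<phi>}| <o \<kappa>"
proof -
  obtain C :: "'k set" where C: "infinite C" "|atoms (\<Union>n. row n)| \<le>o |C|"
      "|underS \<kappa> \<beta>| \<le>o |C|" "|C| <o \<kappa>"
    using ordLess_infinite_bound[OF atoms_ordLess[OF all_rows_ordLess] underS_card] .
  obtain D :: "'k \<Rightarrow> 'k set" where D: "\<And>\<gamma>. |D \<gamma>| <o \<kappa>" "\<And>\<gamma>. |C| \<le>o |D \<gamma>|"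
    "\<And>\<gamma> \<delta>. \<delta> \<in> underS \<kappa> \<gamma> \<Longrightarrow> |Pow (D \<delta>)| \<le>o |D \<gamma>|"
    using iterated_powers[OF C(4)] by blast
  have inf: "infinite (D \<gamma>)" for \<gamma>
    using C(1) D(2) card_of_ordLeq_infinite by blast
  have "|{\<phi>. basic \<gamma> n \<phi>}| \<le>o |Pow (D \<gamma>)|" if "\<gamma> = \<beta> \<or> \<gamma> \<in> underS \<kappa> \<beta>" for \<gamma>
    using that
  proof (induction \<gamma> arbitrary: n rule: underS_induct)
    case (less \<gamma>)
    have D_Pow: "|D \<gamma>| \<le>o |Pow (D \<gamma>)|"
      using card_of_Pow ordLess_imp_ordLeq by blast
    have inf': "infinite (Pow (D \<gamma>))"
      using inf by simp
    have "|(\<lambda>T. FEx \<iota> (var n) (Conj \<kappa> T)) ` Pow (literals \<delta> (Suc n))| \<le>o |Pow (D \<gamma>)|"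
      if \<delta>: "\<delta> \<in> underS \<kappa> \<gamma>" for \<delta>
    proof -
      have "\<delta> \<in> underS \<kappa> \<beta>"
        using \<delta> less.prems underS_trans by blast
      then have "|{\<phi>. basic \<delta> (Suc n) \<phi>}| \<le>o |D \<gamma>|"
        using less.IH[OF \<delta>] D(3)[OF \<delta>] ordLeq_transitive by blast
      then have "|literals \<delta> (Suc n)| \<le>o |D \<gamma>|"
        unfolding literals_def
        using card_of_Un_ordLeq_infinite_Field[of "|D \<gamma>|"] inf card_of_image ordLeq_transitive
        by (metis Field_card_of card_of_Card_order)
      then show ?thesis
        using card_of_Pow_mono card_of_image ordLeq_transitive by blast
    qed
    moreover have "|underS \<kappa> \<gamma>| \<le>o |Pow (D \<gamma>)|"
    proof -
      have "underS \<kappa> \<gamma> \<subseteq> underS \<kappa> \<beta>"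
        using less.prems underS_trans by blast
      then have "|underS \<kappa> \<gamma>| \<le>o |C|"
        using C(3) card_of_mono1 ordLeq_transitive by blast
      then show ?thesis
        using D(2) D_Pow ordLeq_transitive by metis
    qed
    ultimately have "|\<Union>\<delta>\<in>underS \<kappa> \<gamma>. (\<lambda>T. FEx \<iota> (var n) (Conj \<kappa> T)) `
        Pow (literals \<delta> (Suc n))| \<le>o |Pow (D \<gamma>)|"
      using inf' by (intro card_of_UNION_ordLeq_infinite) auto
    moreover have "|atoms (\<Union>n. row n)| \<le>o |Pow (D \<gamma>)|"
      using C(2) D(2) D_Pow ordLeq_transitive by metis
    ultimately show ?case
      using card_of_Un_ordLeq_infinite_Field[of "|Pow (D \<gamma>)|"] inf' card_of_mono1[OF basic_subset]
        ordLeq_transitive by (metis Field_card_of card_of_Card_order)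
  qed
  then show ?thesis
    using Pow_ordLess[OF D(1)] ordLeq_ordLess_trans by blast
qed

lemma literals_ordLess: "|literals \<gamma> n| <o \<kappa>"
  unfolding literals_def by (intro Un_ordLess image_ordLess basic_ordLess)

lemma basic_formula:
  "basic \<gamma> n \<phi> \<Longrightarrow> is_formula \<kappa> \<tau> \<phi> \<and> free_vars \<kappa> \<tau> \<phi> \<subseteq> rows n"
proof (induction rule: basic.induct)
  case (atom \<phi> n \<gamma>)
  have "trm_csts t \<subseteq> cst_syms \<tau> \<and> trm_vars t \<subseteq> rows n" if "t \<in> terms (rows n)" for t
    using that by (auto simp: terms_def)
  with atom show ?case
    unfolding atoms_def by (fastforce dest: PiE_mem)
next
  case (ex \<delta> \<gamma> T n)
  have "T \<subseteq> literals \<delta> (Suc n)"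
    using ex.IH by (auto simp: literals_def)
  then have T: "|T| <o \<kappa>"
    using literals_ordLess subset_ordLess by blast
  have "is_formula \<kappa> \<tau> \<phi> \<and> free_vars \<kappa> \<tau> \<phi> \<subseteq> rows (Suc n)" if "\<phi> \<in> T" for \<phi>
    using ex.IH that by fastforce
  then have "is_formula \<kappa> \<tau> (Conj \<kappa> T)" "free_vars \<kappa> \<tau> (Conj \<kappa> T) \<subseteq> rows (Suc n)"
    unfolding Conj_simps(2,3)[OF T] by blast+
  moreover have "inj_on (var n) (underS \<kappa> \<iota>)"
    using var_inj by (auto simp: inj_on_def)
  ultimately show ?case
    by (auto simp: rows_Suc row_def)
qed

section \<open>Chain models with the same basic theory\<close>

definition agree :: "'k \<Rightarrow> nat \<Rightarrow> ('r, 'c, 'k, 'a) chain_struct \<Rightarrow> ('k \<Rightarrow> 'a) \<Rightarrow>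
    ('r, 'c, 'k, 'a) chain_struct \<Rightarrow> ('k \<Rightarrow> 'a) \<Rightarrow> bool" where
  "agree \<gamma> n P s Q t \<longleftrightarrow>
     (\<forall>\<phi>. basic \<gamma> n \<phi> \<longrightarrow> (chain_sat \<kappa> \<tau> P \<phi> s \<longleftrightarrow> chain_sat \<kappa> \<tau> Q \<phi> t))"

lemma agree_sym: "agree \<gamma> n P s Q t \<Longrightarrow> agree \<gamma> n Q t P s"
  by (simp add: agree_def)

text \<open>
  The conjunction of this set describes the basic theory of \<open>(P, s)\<close>, see \<open>chain_sat_char\<close>.
\<close>

definition char_set :: "'k \<Rightarrow> nat \<Rightarrow> ('r, 'c, 'k, 'a) chain_struct \<Rightarrow> ('k \<Rightarrow> 'a) \<Rightarrow>
    ('r, 'c, 'k) form set" where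
  "char_set \<gamma> n P s = {\<phi> \<in> literals \<gamma> n. chain_sat \<kappa> \<tau> P \<phi> s}"

lemma char_set_ordLess: "|char_set \<gamma> n P s| <o \<kappa>"
  by (rule subset_ordLess[OF _ literals_ordLess]) (auto simp: char_set_def)

lemma chain_sat_char:
  "chain_sat \<kappa> \<tau> Q (Conj \<kappa> (char_set \<gamma> n P s)) t \<longleftrightarrow> agree \<gamma> n P s Q t"
  unfolding Conj_simps(1)[OF char_set_ordLess]
  unfolding agree_def char_set_def literals_def by auto

text \<open>
  The forth property: the existence of a row with the basic theory of \<open>s'\<close> is itself a basic formula
  of the larger rank, hence is transferred from \<open>s\<close> to \<open>t\<close>.
\<close>

lemma agree_step:
  assumes "agree \<gamma> n P s Q t" "\<delta> \<in> underS \<kappa> \<gamma>"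
    and "\<And>v. v \<in> row n \<Longrightarrow> s' v \<in> snd P k" "\<And>v. v \<notin> row n \<Longrightarrow> s' v = s v"
  obtains t' l where "\<And>v. v \<in> row n \<Longrightarrow> t' v \<in> snd Q l" "\<And>v. v \<notin> row n \<Longrightarrow> t' v = t v"
    "agree \<delta> (Suc n) P s' Q t'"
proof -
  let ?\<phi> = "FEx \<iota> (var n) (Conj \<kappa> (char_set \<delta> (Suc n) P s'))"
  have "basic \<gamma> n ?\<phi>"
    using assms(2) by (rule basic.ex) (auto simp: char_set_def literals_def)
  moreover have "chain_sat \<kappa> \<tau> P ?\<phi> s"
  proof -
    have "agree \<delta> (Suc n) P s' P s'"
      by (simp add: agree_def)
    then show ?thesis
      using assms(3,4) unfolding row_def chain_sat.simps chain_sat_char by blast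
  qed
  ultimately have "chain_sat \<kappa> \<tau> Q ?\<phi> t"
    using assms(1) by (simp only: agree_def)
  then show thesis
    using that unfolding row_def chain_sat.simps chain_sat_char by blast
qed

end

section \<open>Partial isomorphisms from assignments\<close>

text \<open>
  The partial map \<open>s v \<mapsto> t v\<close> for \<open>v \<in> W\<close>, which is independent of the choice of \<open>v\<close> whenever
  \<open>s v = s w\<close> implies \<open>t v = t w\<close> on \<open>W\<close>.
\<close>

definition matching :: "'v set \<Rightarrow> ('v \<Rightarrow> 'a) \<Rightarrow> ('v \<Rightarrow> 'b) \<Rightarrow> 'a \<rightharpoonup> 'b" where
  "matching W s t a = (if a \<in> s ` W then Some (t (SOME v. v \<in> W \<and> s v = a)) else None)"

lemma matching_apply:
  assumes "\<And>v w. v \<in> W \<Longrightarrow> w \<in> W \<Longrightarrow> s v = s w \<Longrightarrow> t v = t w" "v \<in> W"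
  shows "matching W s t (s v) = Some (t v)"
proof -
  have "\<exists>w. w \<in> W \<and> s w = s v"
    using assms(2) by blast
  then have "(SOME w. w \<in> W \<and> s w = s v) \<in> W \<and> s (SOME w. w \<in> W \<and> s w = s v) = s v"
    by (rule someI_ex)
  then have "t (SOME w. w \<in> W \<and> s w = s v) = t v"
    using assms by blast
  then show ?thesis
    using assms(2) by (auto simp: matching_def)
qed

lemma dom_matching: "dom (matching W s t) = s ` W"
  by (auto simp: matching_def dom_def)

lemma ran_matching:
  assumes "\<And>v w. v \<in> W \<Longrightarrow> w \<in> W \<Longrightarrow> s v = s w \<Longrightarrow> t v = t w"
  shows "ran (matching W s t) = t ` W"
proof -
  have "b \<in> t ` W" if b: "matching W s t a = Some b" for a b
  proof -
    obtain v where v: "v \<in> W" "a = s v"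
      using b unfolding matching_def by (auto split: if_splits)
    have "matching W s t (s v) = Some (t v)"
      using assms v(1) by (rule matching_apply)
    with b v show ?thesis by auto
  qed
  moreover have "t v \<in> ran (matching W s t)" if "v \<in> W" for v
  proof -
    have "matching W s t (s v) = Some (t v)"
      using assms that by (rule matching_apply)
    then show ?thesis
      by (rule ranI)
  qed
  ultimately show ?thesis
    by (auto simp: ran_def)
qed

context formula_rows
begin

text \<open>
  The constants are values of terms as well, so that \<open>trm_val s u \<mapsto> trm_val t u\<close> defines the
  extension to the generated substructures. The atoms say that it is well defined, injective and
  preserves the relations.
\<close>

lemma atoms_partial_iso:
  assumes agree: "\<And>\<phi>. \<phi> \<in> atoms W \<Longrightarrow> chain_sat \<kappa> \<tau> P \<phi> s \<longleftrightarrow> chain_sat \<kappa> \<tau> Q \<phi> t"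
    and ran: "s ` W \<subseteq> univ (fst P)" "t ` W \<subseteq> univ (fst Q)"
  shows "partial_iso \<kappa> \<tau> (fst P) (fst Q) (matching W s t)"
proof -
  let ?M = "fst P" and ?N = "fst Q"
  have eq: "trm_val ?M s u = trm_val ?M s u' \<longleftrightarrow> trm_val ?N t u = trm_val ?N t u'"
    if "u \<in> terms W" "u' \<in> terms W" for u u'
    using agree[of "FEq u u'"] that by (auto simp: atoms_def)
  have eq_var: "s v = s w \<longleftrightarrow> t v = t w" if "v \<in> W" "w \<in> W" for v w
    using eq[of "Var v" "Var w"] that by (simp add: terms_def)
  have gen: "generated \<tau> K (x ` W) = trm_val K x ` terms W" for K :: "('r, 'c, 'k, 'a) struct" and x
    unfolding generated_def terms_def by (auto simp: image_Un image_image)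
  define pick where "pick a = (SOME u. u \<in> terms W \<and> trm_val ?M s u = a)" for a
  have pick: "pick a \<in> terms W \<and> trm_val ?M s (pick a) = a" if "a \<in> trm_val ?M s ` terms W" for a
  proof -
    have "\<exists>u. u \<in> terms W \<and> trm_val ?M s u = a"
      using that by blast
    then show ?thesis
      unfolding pick_def by (rule someI_ex)
  qed
  define \<rho> where "\<rho> a = trm_val ?N t (pick a)" for a
  have \<rho>: "\<rho> (trm_val ?M s u) = trm_val ?N t u" if "u \<in> terms W" for u
    using eq pick that unfolding \<rho>_def by blast
  have dom: "dom (matching W s t) = s ` W"
    by (rule dom_matching)
  have ran_eq: "ran (matching W s t) = t ` W"
    using eq_var by (intro ran_matching) blast
  have bij: "bij_betw \<rho> (trm_val ?M s ` terms W) (trm_val ?N t ` terms W)"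
    unfolding bij_betw_def
  proof
    show "inj_on \<rho> (trm_val ?M s ` terms W)"
      using eq by (auto simp: inj_on_def \<rho>)
    show "\<rho> ` trm_val ?M s ` terms W = trm_val ?N t ` terms W"
      unfolding image_image by (rule image_cong) (simp_all add: \<rho>)
  qed
  have "matching W s t a = Some (\<rho> a)" if "a \<in> s ` W" for a
  proof -
    from that obtain v where v: "v \<in> W" "a = s v" by blast
    have "\<rho> (s v) = t v"
      using \<rho>[of "Var v"] v by (simp add: terms_def)
    then show ?thesis
      using matching_apply[of W s t v] eq_var v by simp
  qed
  moreover have "\<rho> (cst ?M c) = cst ?N c" if "c \<in> cst_syms \<tau>" for c
    using \<rho>[of "Cst c"] that by (simp add: terms_def)
  moreover have "a \<in> rel ?M R \<longleftrightarrow> restrict (\<lambda>i. \<rho> (a i)) (underS \<kappa> (arity \<tau> R)) \<in> rel ?N R"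
    if R: "R \<in> rel_syms \<tau>" and a: "a \<in> tuples \<kappa> (arity \<tau> R) (trm_val ?M s ` terms W)" for R a
  proof -
    let ?I = "underS \<kappa> (arity \<tau> R)"
    define r where "r = restrict (\<lambda>i. pick (a i)) ?I"
    have r: "r i \<in> terms W" "trm_val ?M s (r i) = a i" if "i \<in> ?I" for i
      using a pick[of "a i"] that by (auto simp: r_def tuples_def)
    have "restrict (\<lambda>i. trm_val ?M s (r i)) ?I = a"
      using a r(2) by (auto simp: tuples_def PiE_def extensional_def fun_eq_iff)
    moreover have "restrict (\<lambda>i. trm_val ?N t (r i)) ?I = restrict (\<lambda>i. \<rho> (a i)) ?I"
      using r \<rho> by (auto simp: fun_eq_iff) metis
    moreover have "r \<in> ?I \<rightarrow>\<^sub>E terms W"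
      using r(1) by (auto simp: r_def)
    ultimately show ?thesis
      using agree[of "FRel R r"] R by (auto simp: atoms_def)
  qed
  ultimately show ?thesis
    unfolding partial_iso_def dom ran_eq gen using ran bij by blast
qed

lemma agree_atoms:
  assumes "agree \<gamma> n P s Q t" "W \<subseteq> rows n" "\<phi> \<in> atoms W"
  shows "chain_sat \<kappa> \<tau> P \<phi> s \<longleftrightarrow> chain_sat \<kappa> \<tau> Q \<phi> t"
  using assms atoms_mono basic.atom unfolding agree_def by blast

lemma agree_eq:
  assumes "agree \<gamma> n P s Q t" "v \<in> rows n" "w \<in> rows n"
  shows "s v = s w \<longleftrightarrow> t v = t w"
  using agree_atoms[OF assms(1) order_refl, of "FEq (Var v) (Var w)"] assms(2,3)
  by (auto simp: atoms_def terms_def)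

end

section \<open>Player II's strategy\<close>

definition level :: "(nat \<Rightarrow> 'a set) \<Rightarrow> 'a \<Rightarrow> nat" where
  "level A x = (LEAST n. x \<in> A n)"

lemma weak_chain_modelsD:
  assumes "P \<in> weak_chain_models \<kappa> \<tau>"
  shows "fst P \<in> structures \<kappa> \<tau>" "univ (fst P) = (\<Union>n. snd P n)" "univ (fst P) \<noteq> {}"
    "m \<le> n \<Longrightarrow> snd P m \<subseteq> snd P n"
proof -
  show *: "fst P \<in> structures \<kappa> \<tau>" "univ (fst P) = (\<Union>n. snd P n)"
    using assms by (auto simp: weak_chain_models_def)
  show "univ (fst P) \<noteq> {}"
    using *(1) by (simp add: structures_def)
  have "snd P n \<subseteq> snd P (Suc n)" for n
    using assms unfolding weak_chain_models_def by (cases P) auto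
  then show "m \<le> n \<Longrightarrow> snd P m \<subseteq> snd P n"
    by (rule lift_Suc_mono_le)
qed

lemma in_level:
  assumes "P \<in> weak_chain_models \<kappa> \<tau>" "x \<in> univ (fst P)" "level (snd P) x \<le> n"
  shows "x \<in> snd P n"
proof -
  have "\<exists>n. x \<in> snd P n"
    using assms weak_chain_modelsD(2) by blast
  then have "x \<in> snd P (level (snd P) x)"
    unfolding level_def by (rule LeastI_ex)
  then show ?thesis
    using weak_chain_modelsD(4)[OF assms(1,3)] by blast
qed

context formula_rows
begin

text \<open>
  One move, when all elements \<open>S\<close> due in this round belong to the structure of \<open>P\<close>. The new row
  enumerates \<open>S\<close>; if \<open>S\<close> is empty, it has to be filled with some element all the same, and the member
  of the chain from which the row is taken has to contain that element.
\<close>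

lemma extend_one_side:
  assumes P: "P \<in> weak_chain_models \<kappa> \<tau>" and Q: "Q \<in> weak_chain_models \<kappa> \<tau>"
    and agree: "agree \<gamma> n P s Q t" "\<delta> \<in> underS \<kappa> \<gamma>"
    and ran: "range s \<subseteq> univ (fst P)" "range t \<subseteq> univ (fst Q)"
    and S: "S \<subseteq> snd P k" "|S| \<le>o |underS \<kappa> \<iota>|"
  obtains s' t' where "range s' \<subseteq> univ (fst P)" "range t' \<subseteq> univ (fst Q)"
    "\<And>v. v \<notin> row n \<Longrightarrow> s' v = s v \<and> t' v = t v"
    "S \<subseteq> s' ` row n" "agree \<delta> (Suc n) P s' Q t'"
proof -
  have "\<exists>e j. e ` underS \<kappa> \<iota> \<subseteq> snd P j \<and> S \<subseteq> e ` underS \<kappa> \<iota>"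
  proof (cases "S = {}")
    case True
    obtain a j where "a \<in> snd P j"
      using weak_chain_modelsD(2,3)[OF P] by blast
    with True show ?thesis
      by (intro exI[of _ "\<lambda>_. a"] exI[of _ j]) auto
  next
    case False
    then show ?thesis
      using S card_of_ordLeq2 by (metis order_refl)
  qed
  then obtain e j where e: "e ` underS \<kappa> \<iota> \<subseteq> snd P j" "S \<subseteq> e ` underS \<kappa> \<iota>"
    by blast
  define s' where "s' v = (if v \<in> row n then e (THE i. v = var n i) else s v)" for v
  have s'_var: "s' (var n i) = e i" if "i \<in> underS \<kappa> \<iota>" for i
  proof -
    have "(THE i'. var n i = var n i') = i"
      using var_inj by blast
    then show ?thesis
      using that by (simp add: s'_def row_def)
  qed
  have s'_row: "s' ` row n = e ` underS \<kappa> \<iota>"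
    unfolding row_def image_image using s'_var by (rule image_cong[OF refl])
  have s'_off: "s' v = s v" if "v \<notin> row n" for v
    using that by (simp add: s'_def)
  obtain t' l where t': "\<And>v. v \<in> row n \<Longrightarrow> t' v \<in> snd Q l" "\<And>v. v \<notin> row n \<Longrightarrow> t' v = t v"
    "agree \<delta> (Suc n) P s' Q t'"
    using agree_step[OF agree, of s' j] s'_row e(1) s'_off by blast
  show thesis
  proof
    show "range s' \<subseteq> univ (fst P)"
    proof safe
      fix v
      have "s' v \<in> (\<Union>n. snd P n)" if "v \<in> row n"
        using s'_row e(1) that by blast
      moreover have "s' v \<in> univ (fst P)" if "v \<notin> row n"
        using s'_off[OF that] ran(1) by auto
      ultimately show "s' v \<in> univ (fst P)"
        using weak_chain_modelsD(2)[OF P] by blast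
    qed
    show "range t' \<subseteq> univ (fst Q)"
    proof safe
      fix v
      have "t' v \<in> (\<Union>n. snd Q n)" if "v \<in> row n"
        using t'(1)[OF that] by blast
      moreover have "t' v \<in> univ (fst Q)" if "v \<notin> row n"
        using t'(2)[OF that] ran(2) by auto
      ultimately show "t' v \<in> univ (fst Q)"
        using weak_chain_modelsD(2)[OF Q] by blast
    qed
  qed (use t' s'_off s'_row e in auto)
qed

text \<open>
  The positions of the game are pairs of assignments \<open>s\<close> and \<open>t\<close>, of which the first \<open>n\<close> rows matter
  at the beginning of round \<open>n\<close>; the reply changes row \<open>n\<close>. The last clause says that the new row
  covers what is due in round \<open>n\<close> when the values of the functions \<open>h\<close> are twice the levels.
\<close>

definition good_reply where
  "good_reply P Q p n s t s' t' \<longleftrightarrow>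
     agree (fst (p ! n)) (Suc n) P s' Q t' \<and>
     range s' \<subseteq> univ (fst P) \<and> range t' \<subseteq> univ (fst Q) \<and>
     (\<forall>v. v \<notin> row n \<longrightarrow> s' v = s v \<and> t' v = t v) \<and>
     (\<forall>m\<le>n. \<forall>x\<in>snd (p ! m). m + 2 * level (snd (if even m then P else Q)) x = n \<longrightarrow>
        x \<in> (if even m then s' else t') ` row n)"

text \<open>
  An element from round \<open>m\<close> is due in round \<open>n\<close> only if \<open>n - m\<close> is twice its level, hence even. So
  only one of the two structures is concerned, and \<open>extend_one_side\<close> applies, with the two sides
  exchanged in odd rounds.
\<close>

lemma good_reply_exists:
  assumes P: "P \<in> weak_chain_models \<kappa> \<tau>" and Q: "Q \<in> weak_chain_models \<kappa> \<tau>"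
    and agree: "agree \<gamma> n P s Q t" "fst (p ! n) \<in> underS \<kappa> \<gamma>"
    and ran: "range s \<subseteq> univ (fst P)" "range t \<subseteq> univ (fst Q)"
    and p: "\<And>m. m \<le> n \<Longrightarrow> snd (p ! m) \<subseteq> univ (fst (if even m then P else Q))"
      "\<And>m. m \<le> n \<Longrightarrow> |snd (p ! m)| \<le>o |underS \<kappa> \<iota>|"
  shows "\<exists>s' t'. good_reply P Q p n s t s' t'"
proof -
  let ?R = "if even n then P else Q"
  define S where "S = {x. \<exists>m\<le>n. even m = even n \<and> x \<in> snd (p ! m) \<and> m + 2 * level (snd ?R) x = n}"
  have R: "?R \<in> weak_chain_models \<kappa> \<tau>"
    using P Q by simp
  have "x \<in> snd ?R n" if "x \<in> S" for x
  proof (rule in_level[OF R])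
    from that obtain m where m: "m \<le> n" "even m = even n" "x \<in> snd (p ! m)"
      "m + 2 * level (snd ?R) x = n"
      unfolding S_def by blast
    show "x \<in> univ (fst ?R)"
      using p(1)[OF m(1)] m(2,3) by auto
    show "level (snd ?R) x \<le> n"
      using m(4) by linarith
  qed
  then have S1: "S \<subseteq> snd ?R n"
    by blast
  have "|\<Union>m\<in>{..n}. snd (p ! m)| \<le>o |underS \<kappa> \<iota>|"
  proof (rule card_of_UNION_ordLeq_infinite[OF infinite_row])
    show "|{..n}| \<le>o |underS \<kappa> \<iota>|"
      using card_of_mono1[OF subset_UNIV, of "{..n}"] infinite_row ordLeq_transitive
      unfolding infinite_iff_card_of_nat by blast
  qed (use p(2) in auto)
  moreover have "S \<subseteq> (\<Union>m\<in>{..n}. snd (p ! m))"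
    unfolding S_def by auto
  ultimately have S2: "|S| \<le>o |underS \<kappa> \<iota>|"
    using card_of_mono1 ordLeq_transitive by blast
  have S: "x \<in> S \<and> even m = even n"
    if "m \<le> n" "x \<in> snd (p ! m)" "m + 2 * level (snd (if even m then P else Q)) x = n" for m x
  proof -
    have "even m = even n"
      using that(3) by presburger
    with that show ?thesis
      unfolding S_def by auto
  qed
  show ?thesis
  proof (cases "even n")
    case True
    then have "S \<subseteq> snd P n"
      using S1 by simp
    from extend_one_side[OF P Q agree ran this S2] obtain s' t' where
      "range s' \<subseteq> univ (fst P)" "range t' \<subseteq> univ (fst Q)"
      "\<And>v. v \<notin> row n \<Longrightarrow> s' v = s v \<and> t' v = t v"
      "S \<subseteq> s' ` row n" "agree (fst (p ! n)) (Suc n) P s' Q t'"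
      by blast
    moreover have "x \<in> (if even m then s' else t') ` row n"
      if "m \<le> n" "x \<in> snd (p ! m)" "m + 2 * level (snd (if even m then P else Q)) x = n" for m x
      using S[OF that] True \<open>S \<subseteq> s' ` row n\<close> by auto
    ultimately have "good_reply P Q p n s t s' t'"
      unfolding good_reply_def by simp
    then show ?thesis by blast
  next
    case False
    then have "S \<subseteq> snd Q n"
      using S1 by simp
    from extend_one_side[OF Q P agree_sym[OF agree(1)] agree(2) ran(2,1) this S2] obtain t' s' where
      "range t' \<subseteq> univ (fst Q)" "range s' \<subseteq> univ (fst P)"
      "\<And>v. v \<notin> row n \<Longrightarrow> t' v = t v \<and> s' v = s v"
      "S \<subseteq> t' ` row n" "agree (fst (p ! n)) (Suc n) Q t' P s'"
      by blast
    moreover have "x \<in> (if even m then s' else t') ` row n"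
      if "m \<le> n" "x \<in> snd (p ! m)" "m + 2 * level (snd (if even m then P else Q)) x = n" for m x
      using S[OF that] False \<open>S \<subseteq> t' ` row n\<close> by auto
    ultimately have "good_reply P Q p n s t s' t'"
      unfolding good_reply_def by (simp add: agree_sym)
    then show ?thesis by blast
  qed
qed

primrec position where
  "position P Q st p 0 = st"
| "position P Q st p (Suc n) = (SOME st'.
     good_reply P Q p n (fst (position P Q st p n)) (snd (position P Q st p n)) (fst st') (snd st'))"

text \<open>
  Player II only looks at the moves made so far, so the strategy is well defined on initial parts of
  a play.
\<close>

lemma position_take: "n \<le> k \<Longrightarrow> position P Q st (take k p) n = position P Q st p n"
proof (induction n)
  case (Suc n)
  have "good_reply P Q (take k p) n = good_reply P Q p n"
    using Suc.prems by (auto simp: good_reply_def fun_eq_iff)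
  with Suc show ?case by simp
qed simp

text \<open>
  The round about to be answered is \<open>length p - 1\<close>. In round 0 the rules fix the domain of the partial
  isomorphism to be the block \<open>h\<^sub>0 = 0\<close>, which may be smaller than the range of the row because of the
  filling; the matching is cut down accordingly. From round 1 on, all rows chosen so far are matched.
\<close>

definition strategy where
  "strategy P Q st \<theta>\<^sub>0 p =
     (\<lambda>x. 2 * level (snd (if odd (length p) then P else Q)) x,
      let (s, t) = position P Q st p (length p) in
      matching
        (if length p = 1 then {v \<in> rows 1. s v \<in> snd (p ! 0) \<and> level (snd P) (s v) = 0}
         else rows (length p)) s t)"

text \<open>
  Along every play, the two positions agree on the basic formulas whose rank is the last ordinal
  chosen by Player I: the rank falls from round to round exactly as the ordinals do.
\<close>

lemma agree_bg_sim:
  fixes \<theta> :: "'k rel"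
  assumes P: "P \<in> weak_chain_models \<kappa> \<tau>" and Q: "Q \<in> weak_chain_models \<kappa> \<tau>"
    and agree: "agree \<beta> 0 P s Q t"
    and ran: "range s \<subseteq> univ (fst P)" "range t \<subseteq> univ (fst Q)"
    and \<theta>: "\<theta> \<le>o |underS \<kappa> \<iota>|"
  shows "(fst P, fst Q) \<in> bg_sim \<kappa> \<tau> \<beta> \<theta>"
proof -
  define \<sigma> :: "('k, 'a) strategyII" where "\<sigma> = strategy P Q (s, t)"
  have "winning_strategyII \<kappa> \<tau> (fst P) (fst Q) \<beta> \<theta> \<sigma>"
    unfolding winning_strategyII_def
  proof (intro allI impI)
    fix \<theta>\<^sub>0 :: "'k rel" and p :: "('k, 'a) movesI" and n
    assume legal: "legal_playI \<kappa> (fst P) (fst Q) \<beta> \<theta> \<theta>\<^sub>0 p" and n: "n < length p"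
    \<comment> \<open>The ordinal below which Player I has to choose in round \<open>n\<close>.\<close>
    define bound where "bound n = (if n = 0 then \<beta> else fst (p ! (n - 1)))" for n
    define x where "x n = fst (position P Q (s, t) p n)" for n
    define y where "y n = snd (position P Q (s, t) p n)" for n
    have ord: "fst (p ! m) \<in> underS \<kappa> (bound m)" if "m < length p" for m
      using legal that unfolding legal_playI_def bound_def by auto
    have moves: "snd (p ! m) \<subseteq> univ (fst (if even m then P else Q))"
      "|snd (p ! m)| \<le>o |underS \<kappa> \<iota>|" if "m < length p" for m
    proof -
      have *: "snd (p ! m) \<in> subsets_of_card (if even m then univ (fst P) else univ (fst Q)) \<theta>\<^sub>0"
        and "\<theta>\<^sub>0 \<le>o \<theta>"
        using legal that unfolding legal_playI_def by auto
      then show "|snd (p ! m)| \<le>o |underS \<kappa> \<iota>|"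
        using ordIso_ordLeq_trans[OF _ ordLeq_transitive[OF _ \<theta>]]
        unfolding subsets_of_card_def by blast
      show "snd (p ! m) \<subseteq> univ (fst (if even m then P else Q))"
        using * by (auto simp: subsets_of_card_def)
    qed
    have step: "good_reply P Q p m (x m) (y m) (x (Suc m)) (y (Suc m))"
      if inv: "agree (bound m) m P (x m) Q (y m)" "range (x m) \<subseteq> univ (fst P)"
        "range (y m) \<subseteq> univ (fst Q)" and m: "m < length p" for m
    proof -
      have "\<exists>s' t'. good_reply P Q p m (x m) (y m) s' t'"
        by (rule good_reply_exists[OF P Q inv(1) ord[OF m] inv(2,3)]; rule moves; use m in simp)
      then have "\<exists>st'. good_reply P Q p m (x m) (y m) (fst st') (snd st')"
        by simp
      then have "good_reply P Q p m (x m) (y m)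
          (fst (SOME st'. good_reply P Q p m (x m) (y m) (fst st') (snd st')))
          (snd (SOME st'. good_reply P Q p m (x m) (y m) (fst st') (snd st')))"
        by (rule someI_ex)
      then show ?thesis
        by (simp add: x_def y_def)
    qed
    have inv: "agree (bound m) m P (x m) Q (y m) \<and> range (x m) \<subseteq> univ (fst P) \<and>
        range (y m) \<subseteq> univ (fst Q)" if "m \<le> length p" for m
      using that
    proof (induction m)
      case 0
      then show ?case
        using agree ran by (simp add: bound_def x_def y_def)
    next
      case (Suc m)
      then have "good_reply P Q p m (x m) (y m) (x (Suc m)) (y (Suc m))"
        using step by simp
      then show ?case
        by (simp add: good_reply_def bound_def)
    qed
    have reply: "good_reply P Q p m (x m) (y m) (x (Suc m)) (y (Suc m))" if "m < length p" for m
      using step inv that by simp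
    define W where "W m = (if m = 0 then {v \<in> rows 1. x 1 v \<in> snd (p ! 0) \<and> level (snd P) (x 1 v) = 0}
         else rows (Suc m))" for m
    have W: "W m \<subseteq> rows (Suc m)" for m
      by (auto simp: W_def)
    define q where "q = repliesII \<sigma> \<theta>\<^sub>0 p"
    have q: "fst (q ! m) = (\<lambda>z. 2 * level (snd (if even m then P else Q)) z)"
      "snd (q ! m) = matching (W m) (x (Suc m)) (y (Suc m))" if "m < length p" for m
    proof -
      have len: "length (take (Suc m) p) = Suc m"
        using that by simp
      have "q ! m = \<sigma> \<theta>\<^sub>0 (take (Suc m) p)"
        using that unfolding q_def repliesII_def by simp
      also have "\<dots> = (\<lambda>z. 2 * level (snd (if even m then P else Q)) z,
          matching (W m) (x (Suc m)) (y (Suc m)))"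
        unfolding \<sigma>_def strategy_def len position_take[OF order_refl] x_def y_def W_def
        by (simp add: case_prod_beta)
      finally show "fst (q ! m) = (\<lambda>z. 2 * level (snd (if even m then P else Q)) z)"
        "snd (q ! m) = matching (W m) (x (Suc m)) (y (Suc m))"
        by simp_all
    qed
    have eq: "x (Suc m) v = x (Suc m) w \<longleftrightarrow> y (Suc m) v = y (Suc m) w"
      if "m < length p" "v \<in> W m" "w \<in> W m" for m v w
    proof (rule agree_eq)
      show "agree (bound (Suc m)) (Suc m) P (x (Suc m)) Q (y (Suc m))"
        using inv[of "Suc m"] that(1) by simp
    qed (use W that(2,3) in blast)+
    \<comment> \<open>What is due in round \<open>k\<close> is covered by row \<open>k\<close>.\<close>
    have blocks: "z \<in> (if even m then x (Suc k) else y (Suc k)) ` row k"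
      if "m \<le> k" "k < length p" "z \<in> block p q m (k - m)" for m k z
    proof -
      have "z \<in> snd (p ! m)" "2 * level (snd (if even m then P else Q)) z = k - m"
        using that q(1)[of m] by (auto simp: block_def)
      then show ?thesis
        using reply[OF that(2)] that(1) unfolding good_reply_def by simp
    qed
    show "legal_replyII \<kappa> \<tau> (fst P) (fst Q) p (repliesII \<sigma> \<theta>\<^sub>0 p) n"
      unfolding legal_replyII_def q_def[symmetric]
    proof (intro conjI impI allI)
      have *: "agree (bound (Suc n)) (Suc n) P (x (Suc n)) Q (y (Suc n))"
        "range (x (Suc n)) \<subseteq> univ (fst P)" "range (y (Suc n)) \<subseteq> univ (fst Q)"
        using inv[of "Suc n"] n by simp_all
      show "partial_iso \<kappa> \<tau> (fst P) (fst Q) (snd (q ! n))"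
        unfolding q(2)[OF n] by (rule atoms_partial_iso[OF agree_atoms[OF *(1) W]]) (use * in auto)
    next
      assume "n = 0"
      with n have "0 < length p" by simp
      have "x 1 ` W 0 = block p q 0 0"
      proof
        show "x 1 ` W 0 \<subseteq> block p q 0 0"
          using q(1)[OF \<open>0 < length p\<close>] by (auto simp: W_def block_def)
        show "block p q 0 0 \<subseteq> x 1 ` W 0"
        proof
          fix z assume z: "z \<in> block p q 0 0"
          then obtain v where v: "v \<in> row 0" "z = x 1 v"
            using blocks[of 0 0 z] \<open>0 < length p\<close> by auto
          have "v \<in> W 0"
            using v z q(1)[OF \<open>0 < length p\<close>] by (auto simp: W_def block_def rows_def)
          with v show "z \<in> x 1 ` W 0" by blast
        qed
      qed
      then show "dom (snd (q ! 0)) = block p q 0 0"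
        using q(2)[OF \<open>0 < length p\<close>] by (simp add: dom_matching)
    next
      assume n0: "n > 0"
      then have W_n: "W n = rows (Suc n)"
        by (simp add: W_def)
      have W_mono: "W (n - 1) \<subseteq> rows n"
        using W[of "n - 1"] n0 by simp
      show "snd (q ! (n - 1)) \<subseteq>\<^sub>m snd (q ! n)"
        unfolding map_le_def
      proof
        fix a assume a: "a \<in> dom (snd (q ! (n - 1)))"
        have n1: "n - 1 < length p"
          using n by simp
        obtain v where v: "v \<in> W (n - 1)" "a = x n v"
          using a n0 unfolding q(2)[OF n1] dom_matching by auto
        have "v \<notin> row n"
          using v(1) W_mono rows_row_disjoint by blast
        then have same: "x (Suc n) v = x n v" "y (Suc n) v = y n v"
          using reply[OF n] by (simp_all add: good_reply_def)
        have "matching (W (n - 1)) (x n) (y n) (x n v) = Some (y n v)"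
          using eq[OF n1] v(1) n0 by (intro matching_apply) simp_all
        then have "snd (q ! (n - 1)) a = Some (y n v)"
          using v(2) n0 q(2)[OF n1] by simp
        moreover have "matching (W n) (x (Suc n)) (y (Suc n)) (x (Suc n) v) = Some (y (Suc n) v)"
        proof (rule matching_apply)
          show "v \<in> W n"
            using v(1) W_mono unfolding W_n rows_Suc by blast
        qed (simp add: eq[OF n])
        then have "snd (q ! n) a = Some (y n v)"
          using v(2) same q(2)[OF n] by simp
        ultimately show "snd (q ! (n - 1)) a = snd (q ! n) a" by simp
      qed
    next
      fix m assume n0: "n > 0" and m: "m \<le> n"
      have "row n \<subseteq> W n"
        using n0 by (simp add: W_def rows_Suc)
      moreover have "ran (snd (q ! n)) = y (Suc n) ` W n"
        unfolding q(2)[OF n] using eq[OF n] by (intro ran_matching) blast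
      moreover have "dom (snd (q ! n)) = x (Suc n) ` W n"
        unfolding q(2)[OF n] by (rule dom_matching)
      moreover have "block p q m (n - m) \<subseteq> (if even m then x (Suc n) else y (Suc n)) ` row n"
        using blocks[OF m n] by (rule subsetI)
      ultimately show "if even m then block p q m (n - m) \<subseteq> dom (snd (q ! n))
          else block p q m (n - m) \<subseteq> ran (snd (q ! n))"
        by (cases "even m") (simp_all, (meson image_mono order_trans)+)
    qed
  qed
  then show ?thesis
    unfolding bg_sim_def using weak_chain_modelsD(1) P Q by blast
qed

section \<open>Defining the sentences of Shelah's logic\<close>

text \<open>
  The sentence is the disjunction of the descriptions of the basic theories of all weak chain models
  over \<open>K\<close>. A weak chain model that satisfies it shares its basic theory with one over \<open>K\<close>, and is
  then itself over \<open>K\<close> by \<open>agree_bg_sim\<close>. The assignments \<open>s\<close> occur because basic theories were defined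
  for assignments, although no row has been chosen yet and no variable is free.
\<close>

lemma union_of_classes_definable:
  fixes K :: "('r, 'c, 'k, 'a) struct set" and \<theta> :: "'k rel"
  assumes K: "\<And>M N. M \<in> K \<Longrightarrow> (M, N) \<in> bg_sim \<kappa> \<tau> \<beta> \<theta> \<Longrightarrow> N \<in> K"
    and \<theta>: "\<theta> \<le>o |underS \<kappa> \<iota>|"
  shows "\<exists>\<phi> \<in> Lkk_sentences \<kappa> \<tau>. \<forall>P \<in> weak_chain_models \<kappa> \<tau>. chain_models \<kappa> \<tau> P \<phi> \<longleftrightarrow> fst P \<in> K"
proof -
  define T where "T = {Conj \<kappa> (char_set \<beta> 0 P s) | P s.
    P \<in> weak_chain_models \<kappa> \<tau> \<and> fst P \<in> K \<and> range s \<subseteq> univ (fst P)}"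
  have "T \<subseteq> Conj \<kappa> ` Pow (literals \<beta> 0)"
    unfolding T_def char_set_def by auto
  then have T: "|T| <o \<kappa>"
    by (rule subset_ordLess) (intro image_ordLess Pow_ordLess literals_ordLess)
  have "is_formula \<kappa> \<tau> \<phi> \<and> free_vars \<kappa> \<tau> \<phi> = {}" if "\<phi> \<in> literals \<beta> 0" for \<phi>
    using that basic_formula[of \<beta> 0] unfolding literals_def by (auto simp: rows_def)
  then have "is_formula \<kappa> \<tau> (Conj \<kappa> (char_set \<beta> 0 P s)) \<and>
      free_vars \<kappa> \<tau> (Conj \<kappa> (char_set \<beta> 0 P s)) = {}"
    for P :: "('r, 'c, 'k, 'a) chain_struct" and s :: "'k \<Rightarrow> 'a"
    unfolding Conj_simps(2,3)[OF char_set_ordLess] by (auto simp: char_set_def)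
  then have "Disj \<kappa> T \<in> Lkk_sentences \<kappa> \<tau>"
    unfolding Lkk_sentences_def mem_Collect_eq Disj_simps(2,3)[OF T] by (auto simp: T_def)
  moreover have "chain_models \<kappa> \<tau> P (Disj \<kappa> T) \<longleftrightarrow> fst P \<in> K"
    if P: "P \<in> weak_chain_models \<kappa> \<tau>" for P :: "('r, 'c, 'k, 'a) chain_struct"
  proof
    assume sat: "chain_models \<kappa> \<tau> P (Disj \<kappa> T)"
    obtain a where "a \<in> univ (fst P)"
      using weak_chain_modelsD(3)[OF P] by blast
    then have t: "range (\<lambda>_. a) \<subseteq> univ (fst P)"
      by auto
    then have "chain_sat \<kappa> \<tau> P (Disj \<kappa> T) (\<lambda>_. a)"
      by (rule sat[unfolded chain_models_def, rule_format])
    then obtain Q s where Q: "Q \<in> weak_chain_models \<kappa> \<tau>" "fst Q \<in> K" "range s \<subseteq> univ (fst Q)"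
      and "chain_sat \<kappa> \<tau> P (Conj \<kappa> (char_set \<beta> 0 Q s)) (\<lambda>_. a)"
      unfolding Disj_simps(1)[OF T] unfolding T_def by blast
    then have "agree \<beta> 0 Q s P (\<lambda>_. a)"
      by (simp add: chain_sat_char)
    then have "(fst Q, fst P) \<in> bg_sim \<kappa> \<tau> \<beta> \<theta>"
      using agree_bg_sim Q P t \<theta> by blast
    then show "fst P \<in> K"
      using K Q(2) by blast
  next
    assume K: "fst P \<in> K"
    show "chain_models \<kappa> \<tau> P (Disj \<kappa> T)"
      unfolding chain_models_def
    proof (intro allI impI)
      fix s :: "'k \<Rightarrow> 'a" assume "range s \<subseteq> univ (fst P)"
      then have "Conj \<kappa> (char_set \<beta> 0 P s) \<in> T"
        using P K unfolding T_def by blast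
      moreover have "chain_sat \<kappa> \<tau> P (Conj \<kappa> (char_set \<beta> 0 P s)) s"
        by (simp add: chain_sat_char agree_def)
      ultimately show "chain_sat \<kappa> \<tau> P (Disj \<kappa> T) s"
        unfolding Disj_simps(1)[OF T] by blast
    qed
  qed
  ultimately show ?thesis by blast
qed

end

lemma bg_sim_closed:
  assumes "\<C> \<subseteq> structures \<kappa> \<tau> // bg_equiv \<kappa> \<tau> \<beta> \<theta>" "M \<in> \<Union>\<C>" "(M, N) \<in> bg_sim \<kappa> \<tau> \<beta> \<theta>"
  shows "N \<in> \<Union>\<C>"
proof -
  obtain C M\<^sub>0 where C: "C \<in> \<C>" "M \<in> C" "C = bg_equiv \<kappa> \<tau> \<beta> \<theta> `` {M\<^sub>0}"
    using assms(1,2) unfolding quotient_def by blast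
  then have "N \<in> C"
    using assms(3) unfolding bg_equiv_def by (auto intro: trancl_into_trancl)
  with C(1) show ?thesis by blast
qed

text \<open>
  The rows get length \<open>\<theta> + \<omega>\<close>: at least \<open>\<theta>\<close>, and infinite, so that finitely many sets of
  Player I fit into one row.
\<close>

lemma (in beth_fixed) L1_sentence_definable:
  fixes \<tau> :: "('r, 'c, 'k) vocab"
  assumes \<tau>: "vocabulary \<kappa> \<tau>" and K: "K \<in> L1_sentences \<kappa> \<tau>"
  shows "\<exists>\<phi> \<in> Lkk_sentences \<kappa> \<tau>. \<forall>P \<in> weak_chain_models \<kappa> \<tau>. chain_models \<kappa> \<tau> P \<phi> \<longleftrightarrow> fst P \<in> K"
proof -
  obtain \<theta> \<beta> \<C> where \<theta>: "Card_order \<theta>" "\<theta> <o \<kappa>"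
    and \<C>: "\<C> \<subseteq> structures \<kappa> \<tau> // bg_equiv \<kappa> \<tau> \<beta> \<theta>" "K = \<Union>\<C>"
    using K unfolding L1_sentences_def L1_theta_sentences_def by blast
  have "|Field \<theta>| <o \<kappa>"
    using \<theta> card_of_Field_ordIso ordIso_ordLess_trans by blast
  then have "|Field \<theta> <+> (UNIV :: nat set)| <o \<kappa>"
    using nat_ordLess by (rule Plus_ordLess)
  then obtain \<iota> F where "bij_betw F (underS \<kappa> \<iota>) (Field \<theta> <+> (UNIV :: nat set))"
    by (rule ordLess_bij_underS)
  then have \<iota>: "|Field \<theta> <+> (UNIV :: nat set)| =o |underS \<kappa> \<iota>|"
    using card_of_ordIso ordIso_symmetric by blast
  then have le: "|Field \<theta> <+> (UNIV :: nat set)| \<le>o |underS \<kappa> \<iota>|"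
    by (rule ordIso_imp_ordLeq)
  have "|UNIV :: nat set| \<le>o |underS \<kappa> \<iota>|"
    by (rule ordLeq_transitive[OF card_of_Plus2 le])
  then have inf: "infinite (underS \<kappa> \<iota>)"
    by (simp add: infinite_iff_card_of_nat)
  have "|Field \<theta>| \<le>o |underS \<kappa> \<iota>|"
    by (rule ordLeq_transitive[OF card_of_Plus1 le])
  then have \<theta>_le: "\<theta> \<le>o |underS \<kappa> \<iota>|"
    by (rule ordIso_ordLeq_trans[OF ordIso_symmetric[OF card_of_Field_ordIso[OF \<theta>(1)]]])
  have "|(UNIV :: nat set) \<times> (UNIV :: 'k set)| \<le>o |UNIV :: 'k set|"
    using infinite_UNIV infinite_UNIV[unfolded infinite_iff_card_of_nat]
    by (rule card_of_Sigma_ordLeq_infinite) (simp add: ordLeq_reflexive card_of_Well_order)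
  then obtain v :: "nat \<times> 'k \<Rightarrow> 'k" where "inj v"
    unfolding card_of_ordLeq[symmetric] by auto
  then interpret formula_rows \<kappa> \<tau> \<iota> "\<lambda>n i. v (n, i)"
    using \<tau> inf by unfold_locales (auto simp: inj_def)
  show ?thesis
    using bg_sim_closed[OF \<C>(1)] \<C>(2) by (intro union_of_classes_definable[OF _ \<theta>_le]) blast
qed

theorem theorem5p7:
  fixes \<kappa> :: "'k rel" and \<tau> :: "('r, 'c, 'k) vocab"
  assumes "card_order \<kappa>"
    and "singular_card \<kappa>"
    and "has_cofinality \<kappa> natLeq"
    and "beth_fixed_point \<kappa>"
    and "vocabulary \<kappa> \<tau>"
  shows "logic_le
    (L1_sentences \<kappa> \<tau>, L1_models, structures \<kappa> \<tau> :: ('r, 'c, 'k, 'a) struct set)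
    (Lkk_sentences \<kappa> \<tau>, chain_models \<kappa> \<tau>, weak_chain_models \<kappa> \<tau> :: ('r, 'c, 'k, 'a) chain_struct set)"
proof -
  interpret beth_fixed \<kappa>
    using assms by unfold_locales (auto simp: singular_card_def)
  have "\<forall>K \<in> L1_sentences \<kappa> \<tau> :: ('r, 'c, 'k, 'a) struct set set. \<exists>\<phi>. \<phi> \<in> Lkk_sentences \<kappa> \<tau> \<and>
      (\<forall>P \<in> weak_chain_models \<kappa> \<tau>. chain_models \<kappa> \<tau> P \<phi> \<longleftrightarrow> fst P \<in> K)"
    using L1_sentence_definable[OF assms(5)] by blast
  then obtain f :: "('r, 'c, 'k, 'a) struct set \<Rightarrow> ('r, 'c, 'k) form" where
    f: "\<forall>K \<in> L1_sentences \<kappa> \<tau>. f K \<in> Lkk_sentences \<kappa> \<tau> \<and>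
      (\<forall>P \<in> weak_chain_models \<kappa> \<tau>. chain_models \<kappa> \<tau> P (f K) \<longleftrightarrow> fst P \<in> K)"
    by (elim bchoice[elim_format]) blast
  show ?thesis
    unfolding logic_le.simps L1_models_def
  proof (rule bexI[where x = f], rule bexI[where x = fst], intro conjI ballI impI)
    show "f \<in> L1_sentences \<kappa> \<tau> \<rightarrow> Lkk_sentences \<kappa> \<tau>"
      using f by blast
    show "fst \<in> (weak_chain_models \<kappa> \<tau> :: ('r, 'c, 'k, 'a) chain_struct set) \<rightarrow> structures \<kappa> \<tau>"
      using weak_chain_modelsD(1) by blast
  next
    fix K :: "('r, 'c, 'k, 'a) struct set" and P :: "('r, 'c, 'k, 'a) chain_struct"
    assume "K \<in> L1_sentences \<kappa> \<tau>" "P \<in> weak_chain_models \<kappa> \<tau>"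
    then show "chain_models \<kappa> \<tau> P (f K) \<longleftrightarrow> fst P \<in> K"
      using f by blast
  next
    fix K :: "('r, 'c, 'k, 'a) struct set"
    assume "\<exists>M\<in>structures \<kappa> \<tau>. M \<in> K"
    then obtain M where "M \<in> structures \<kappa> \<tau>" "M \<in> K" by blast
    then show "\<exists>P\<in>weak_chain_models \<kappa> \<tau>. fst P \<in> K"
      by (intro bexI[of _ "(M, \<lambda>_. univ M)"]) (auto simp: weak_chain_models_def)
  qed
qed

end
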